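(* In the setting described in the context (sequence $\{a_n\}$, Dirichlet series $D$, error term $\Delta$, its Mellin transform $A$, and contour $\mathscr{C}$), one has $$A(s)=\frac{1}{2\pi i}\int_{\mathscr{C}}\frac{D(\eta)}{\eta(s-\eta)}\,d\eta$$ for every $s$ lying to the right of $\mathscr{C}$, where $A(s)$ is given by its defining integral in its half plane of absolute convergence and by analytic continuation elsewhere to the right of $\mathscr{C}$.
   Context: Let $\{a_n\}_{n\ge1}$ be a sequence of real numbers and $D(s)=\sum_{n\ge1}a_nn^{-s}$. Suppose there are real numbers $0<\sigma_1<\sigma_2$ such that: (i) $D(s)$ converges absolutely for $\Re(s)>\sigma_2$; (ii) $D(s)$ can be meromorphically continued to the half plane $\Re(s)>\sigma_1$ with only finitely many poles $\rho$ there, all satisfying $\sigma_1<\Re(\rho)\le\sigma_2$; the set of these poles is denoted $\mathcal P$; (iii) the main term is $\mathcal M(x)=\sum_{\rho\in\mathcal P}\mathrm{Res}_{s=\rho}\left(\frac{D(s)x^s}{s}\right)$. For $x\ge1$ let $\sum^*_{n\le x}a_n=\sum_{n\le x}a_n$ if $x\notin\mathbb N$ and $\sum^*_{n\le x}a_n=\sum_{n\le x}a_n-\frac12a_x$ if $x\in\mathbb N$. The error term is $\Delta(x)=\sum^*_{n\le x}a_n-\mathcal M(x)$, and its Mellin transform is $A(s)=\int_1^\infty\Delta(x)x^{-s-1}\,dx$. Contour: choose $\sigma_3>\sigma_2$ and $T_0>0$ with $T_0>|\Im(\rho)|$ for all $\rho\in\mathcal P$; it is assumed that $D$ is analytic on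 a neighbourhood of $\mathscr C$. The contour $\mathscr{C}$, traversed upwards, is the union of the half-line from $\sigma_3-i\infty$ to $\sigma_3-iT_0$, the segment from $\sigma_3-iT_0$ to $\sigma_1-iT_0$, the segment from $\sigma_1-iT_0$ to $\sigma_1+iT_0$, the segment from $\sigma_1+iT_0$ to $\sigma_3+iT_0$, and the half-line from $\sigma_3+iT_0$ to $\sigma_3+i\infty$. "$s$ lies to the right of $\mathscr{C}$" means $\Re(s)>\sigma_3$, or $\Re(s)>\sigma_1$ and $|\Im(s)|<T_0$. *)

theory Defs
  imports "HOL-Complex_Analysis.Complex_Analysis"
begin

text \<open>
  Sequences \<open>(a\<^sub>n)\<close> with \<open>n \<ge> 1\<close> are functions on \<^typ>\<open>nat\<close> whose value at 0 is never used.
\<close>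

definition dirichlet_term :: "(nat \<Rightarrow> real) \<Rightarrow> complex \<Rightarrow> nat \<Rightarrow> complex" where
  "dirichlet_term a s n = complex_of_real (a n) * of_nat n powr (- s)"

definition starred_sum :: "(nat \<Rightarrow> real) \<Rightarrow> real \<Rightarrow> real" where
  "starred_sum a x =
     (\<Sum>n | 1 \<le> n \<and> real n \<le> x. a n) - (if x \<in> \<nat> then a (nat \<lfloor>x\<rfloor>) / 2 else 0)"

definition main_term :: "(complex \<Rightarrow> complex) \<Rightarrow> complex set \<Rightarrow> real \<Rightarrow> complex" where
  "main_term D P x = (\<Sum>\<rho>\<in>P. residue (\<lambda>s. D s * complex_of_real x powr s / s) \<rho>)"

definition error_term ::
    "(nat \<Rightarrow> real) \<Rightarrow> (complex \<Rightarrow> complex) \<Rightarrow> complex set \<Rightarrow> real \<Rightarrow> complex" where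
  "error_term a D P x = complex_of_real (starred_sum a x) - main_term D P x"

definition mellin_abs_convergent :: "(real \<Rightarrow> complex) \<Rightarrow> complex \<Rightarrow> bool" where
  "mellin_abs_convergent \<Delta> s \<longleftrightarrow>
     set_integrable lborel {1..} (\<lambda>x. \<Delta> x * complex_of_real x powr (- s - 1))"

definition mellin_integral :: "(real \<Rightarrow> complex) \<Rightarrow> complex \<Rightarrow> complex" where
  "mellin_integral \<Delta> s =
     set_lebesgue_integral lborel {1..} (\<lambda>x. \<Delta> x * complex_of_real x powr (- s - 1))"

text \<open>
  \<open>A\<close> is the Mellin transform of \<open>\<Delta>\<close>, analytically continued to \<open>R\<close>. For connected open \<open>R\<close>
  that meets the interior of the half plane of absolute convergence, this determines \<open>A\<close> on \<open>R\<close>.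
\<close>

definition mellin_continuation ::
    "(real \<Rightarrow> complex) \<Rightarrow> complex set \<Rightarrow> (complex \<Rightarrow> complex) \<Rightarrow> bool" where
  "mellin_continuation \<Delta> R A \<longleftrightarrow>
     A holomorphic_on R \<and>
     (\<forall>s\<in>R. mellin_abs_convergent \<Delta> s \<longrightarrow> A s = mellin_integral \<Delta> s)"

definition bounded_part :: "real \<Rightarrow> real \<Rightarrow> real \<Rightarrow> real \<Rightarrow> complex" where
  "bounded_part \<sigma>1 \<sigma>3 T0 =
     linepath (Complex \<sigma>3 (- T0)) (Complex \<sigma>1 (- T0)) +++
     linepath (Complex \<sigma>1 (- T0)) (Complex \<sigma>1 T0) +++
     linepath (Complex \<sigma>1 T0) (Complex \<sigma>3 T0)"

definition contour_set :: "real \<Rightarrow> real \<Rightarrow> real \<Rightarrow> complex set" where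
  "contour_set \<sigma>1 \<sigma>3 T0 =
     {z. Re z = \<sigma>3 \<and> Im z \<le> - T0} \<union> path_image (bounded_part \<sigma>1 \<sigma>3 T0) \<union>
     {z. Re z = \<sigma>3 \<and> Im z \<ge> T0}"

definition right_of_contour :: "real \<Rightarrow> real \<Rightarrow> real \<Rightarrow> complex set" where
  "right_of_contour \<sigma>1 \<sigma>3 T0 =
     {s. Re s > \<sigma>3 \<or> (Re s > \<sigma>1 \<and> \<bar>Im s\<bar> < T0)}"

text \<open>
  The library's \<^const>\<open>contour_integral\<close> needs a path on a compact interval, so the two half-lines,
  parametrised by \<open>\<eta> = \<sigma>3 + \<i>t\<close> with \<open>d\<eta> = \<i> dt\<close>, are treated as Lebesgue integrals in \<open>t\<close>.
\<close>

definition full_contour_integrable ::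
    "real \<Rightarrow> real \<Rightarrow> real \<Rightarrow> (complex \<Rightarrow> complex) \<Rightarrow> bool" where
  "full_contour_integrable \<sigma>1 \<sigma>3 T0 f \<longleftrightarrow>
     set_integrable lborel {..- T0} (\<lambda>t. f (Complex \<sigma>3 t)) \<and>
     f contour_integrable_on bounded_part \<sigma>1 \<sigma>3 T0 \<and>
     set_integrable lborel {T0..} (\<lambda>t. f (Complex \<sigma>3 t))"

definition full_contour_integral ::
    "real \<Rightarrow> real \<Rightarrow> real \<Rightarrow> (complex \<Rightarrow> complex) \<Rightarrow> complex" where
  "full_contour_integral \<sigma>1 \<sigma>3 T0 f =
     \<i> * set_lebesgue_integral lborel {..- T0} (\<lambda>t. f (Complex \<sigma>3 t)) +
     contour_integral (bounded_part \<sigma>1 \<sigma>3 T0) f +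
     \<i> * set_lebesgue_integral lborel {T0..} (\<lambda>t. f (Complex \<sigma>3 t))"

end

theory Submission
  imports Defs "HOL-Probability.Sinc_Integral"
begin

text \<open>
  Close the bounded part of the contour by its missing side, the segment from \<open>\<sigma>3 - \<i> T0\<close> to
  \<open>\<sigma>3 + \<i> T0\<close>. This gives a rectangle \<open>R\<close> around all poles in \<open>P\<close>. For \<open>x > 0\<close> the residue theorem
  writes the main term, with all its residues, as the single contour integral
  \<open>1/(2 \<pi> \<i>) \<integral>\<^sub>R D(\<eta>) x\<^sup>\<eta> / \<eta> d\<eta>\<close> (\<open>main_term_eq_contour_integral\<close>).

  Let \<open>Re s > \<sigma>3\<close>. As \<open>1/(s - \<eta>)\<close> is the Mellin transform of \<open>x\<^sup>\<eta>\<close> at \<open>s\<close>, Fubini's theorem turns this into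
  \<open>1/(2 \<pi> \<i>) \<integral>\<^sub>R D(\<eta>) / (\<eta> (s - \<eta>)) d\<eta>\<close> for the Mellin transform of the main term
  (\<open>mellin_linepath_integral\<close>, \<open>has_mellin_main_term\<close>). The starred sum has Mellin transform \<open>D(s)/s\<close>, term by
  term (\<open>mellin_starred_sum\<close>), and Cauchy's formula for the half plane to the right of the line
  \<open>Re \<eta> = \<sigma>3\<close> says that \<open>D(s)/s\<close> is \<open>1/(2 \<pi> \<i>)\<close> times the integral of the same kernel
  \<open>D(\<eta>) / (\<eta> (s - \<eta>))\<close> over that line (\<open>vertical_line_cauchy_formula\<close>). Subtracting \<open>R\<close> from the line
  replaces its middle segment by the bounded part, so what remains is exactly the integral over the
  contour (\<open>has_mellin_error_term\<close>).

  The contour integral is holomorphic in \<open>s\<close> off the contour, because its kernel is dominated by an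
  integrable function locally uniformly in \<open>s\<close> (\<open>holomorphic_on_lebesgue_integral\<close>). It is
  therefore the analytic continuation. The values at \<open>s\<close> with \<open>Re s \<le> \<sigma>3\<close> follow from the
  identity theorem on strips \<open>\<sigma> < Re s\<close>, \<open>\<bar>Im s\<bar> < T0\<close>, which are convex and reach into the half plane
  \<open>Re s > \<sigma>3\<close>. A point \<open>s\<close> on the very boundary of the half plane of absolute
  convergence lies in no such strip on which the Mellin integral is known to be holomorphic; there
  one approaches \<open>s\<close> from the right.
\<close>

section \<open>Holomorphic parameter integrals\<close>

text \<open>
  Cauchy's inequality turns the domination of \<open>f\<close> into one of its \<open>z\<close>-derivative. Hence the
  difference quotients are dominated as well, and dominated convergence lets the derivative
  pass under the integral.
\<close>

lemma holomorphic_on_lebesgue_integral: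
  fixes f :: "complex \<Rightarrow> 'a \<Rightarrow> complex"
  assumes U: "open U"
    and meas: "\<And>z. z \<in> U \<Longrightarrow> f z \<in> borel_measurable M"
    and holo: "\<And>t. t \<in> space M \<Longrightarrow> (\<lambda>z. f z t) holomorphic_on U"
    and dom: "\<And>z. z \<in> U \<Longrightarrow>
      \<exists>r>0. \<exists>g. integrable M g \<and> (\<forall>w\<in>ball z r \<inter> U. \<forall>t\<in>space M. norm (f w t) \<le> g t)"
  shows "(\<lambda>z. integral\<^sup>L M (f z)) holomorphic_on U"
proof -
  have "\<exists>D. ((\<lambda>z. integral\<^sup>L M (f z)) has_field_derivative D) (at z)" if z: "z \<in> U" for z
  proof -
    obtain r g where r: "r > 0" and g: "integrable M g"
      and fg: "\<And>w t. w \<in> ball z r \<inter> U \<Longrightarrow> t \<in> space M \<Longrightarrow> norm (f w t) \<le> g t"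
      using dom[OF z] by blast
    have "open (ball z r \<inter> U)" "z \<in> ball z r \<inter> U"
      using U z r by auto
    then obtain e where e: "e > 0" "ball z e \<subseteq> ball z r \<inter> U"
      using open_contains_ball by blast
    \<comment> \<open>Discs of radius \<open>\<rho>\<close> around points of the \<open>\<rho>\<close>-disc around \<open>z\<close> stay inside the domain of domination.\<close>
    define \<rho> where "\<rho> = e / 3"
    have \<rho>: "\<rho> > 0" and sub: "cball w \<rho> \<subseteq> ball z r \<inter> U" if "w \<in> ball z \<rho>" for w
    proof -
      show "\<rho> > 0" using e by (simp add: \<rho>_def)
      have "cball w \<rho> \<subseteq> ball z e"
      proof
        fix y assume "y \<in> cball w \<rho>"
        then show "y \<in> ball z e"
          using that dist_triangle[of z y w] e(1) by (simp add: \<rho>_def)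
      qed
      with e show "cball w \<rho> \<subseteq> ball z r \<inter> U" by blast
    qed
    have \<rho>pos: "\<rho> > 0" using e by (simp add: \<rho>_def)
    have subz: "ball z \<rho> \<subseteq> ball z r \<inter> U" using sub \<rho>pos by (meson centre_in_cball less_imp_le subset_eq)
    let ?d = "\<lambda>t. deriv (\<lambda>z. f z t)"
    have der: "((\<lambda>z. f z t) has_field_derivative ?d t w) (at w)" if "t \<in> space M" "w \<in> ball z \<rho>" for t w
      using holomorphic_derivI[OF holo[OF that(1)] U] subz that(2) by auto
    have dbound: "norm (?d t w) \<le> g t / \<rho>" if t: "t \<in> space M" and w: "w \<in> ball z \<rho>" for t w
    proof -
      have "norm ((deriv ^^ 1) (\<lambda>z. f z t) w) \<le> fact 1 * g t / \<rho> ^ 1"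
      proof (rule Cauchy_inequality)
        have h: "(\<lambda>z. f z t) holomorphic_on cball w \<rho>"
          using holo[OF t] sub[OF w] holomorphic_on_subset by blast
        show "(\<lambda>z. f z t) holomorphic_on ball w \<rho>"
          using h ball_subset_cball holomorphic_on_subset by blast
        show "continuous_on (cball w \<rho>) (\<lambda>z. f z t)"
          using h by (rule holomorphic_on_imp_continuous_on)
        show "norm (f x t) \<le> g t" if "norm (w - x) = \<rho>" for x
          using sub[OF w] that t by (intro fg) (auto simp: dist_norm)
      qed (use \<rho>pos in auto)
      then show ?thesis by simp
    qed
    have lip: "norm (f w t - f z t) \<le> g t / \<rho> * norm (w - z)" if t: "t \<in> space M" and w: "w \<in> ball z \<rho>" for t w
      by (rule field_differentiable_bound[where S = "ball z \<rho>" and f' = "?d t"])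
         (use der dbound t w \<rho>pos in \<open>auto intro: has_field_derivative_at_within\<close>)
    have int: "integrable M (f w)" if "w \<in> ball z \<rho>" for w
    proof (rule Bochner_Integration.integrable_bound[OF g meas])
      show wU: "w \<in> U" using subz that by auto
      show "AE t in M. norm (f w t) \<le> norm (g t)"
      proof (rule AE_I2)
        fix t assume "t \<in> space M"
        with subz that have "norm (f w t) \<le> g t" by (intro fg) auto
        then show "norm (f w t) \<le> norm (g t)" by simp
      qed
    qed
    have "(\<lambda>w. (integral\<^sup>L M (f w) - integral\<^sup>L M (f z)) / (w - z)) \<midarrow>z\<rightarrow> (\<integral>t. ?d t z \<partial>M)"
      unfolding tendsto_at_iff_sequentially comp_def
    proof (intro allI impI)
      fix X :: "nat \<Rightarrow> complex"
      assume X: "\<forall>i. X i \<in> UNIV - {z}" "X \<longlonglongrightarrow> z"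
      have "eventually (\<lambda>n. X n \<in> ball z \<rho>) sequentially"
        using X(2) \<rho>pos by (intro topological_tendstoD) auto
      then obtain N where N: "\<And>n. n \<ge> N \<Longrightarrow> X n \<in> ball z \<rho>"
        by (auto simp: eventually_sequentially)
      define Y where "Y n = X (n + N)" for n
      have Y: "Y n \<in> ball z \<rho>" "Y n \<noteq> z" for n
        using X N by (auto simp: Y_def)
      have YU: "Y n \<in> U" for n using Y subz by blast
      have Ylim: "Y \<longlonglongrightarrow> z" unfolding Y_def using X(2) by (rule LIMSEQ_ignore_initial_segment)
      have qlim: "(\<lambda>n. (f (Y n) t - f z t) / (Y n - z)) \<longlonglongrightarrow> ?d t z" if "t \<in> space M" for t
      proof -
        have "(\<lambda>w. (f w t - f z t) / (w - z)) \<midarrow>z\<rightarrow> ?d t z"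
          using der[OF that, of z] \<rho>pos unfolding has_field_derivative_iff by simp
        then show ?thesis
          unfolding tendsto_at_iff_sequentially comp_def using Y Ylim by auto
      qed
      have qmeas: "(\<lambda>t. (f (Y n) t - f z t) / (Y n - z)) \<in> borel_measurable M" for n
        using meas[OF z] meas[OF YU[of n]] by measurable
      have "(\<lambda>n. \<integral>t. (f (Y n) t - f z t) / (Y n - z) \<partial>M) \<longlonglongrightarrow> (\<integral>t. ?d t z \<partial>M)"
      proof (rule integral_dominated_convergence[where w = "\<lambda>t. g t / \<rho>"])
        show "(\<lambda>t. ?d t z) \<in> borel_measurable M"
          by (rule borel_measurable_LIMSEQ_metric[OF qmeas qlim])
        show "integrable M (\<lambda>t. g t / \<rho>)" using g by simp
        show "AE t in M. (\<lambda>n. (f (Y n) t - f z t) / (Y n - z)) \<longlonglongrightarrow> ?d t z"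
          using qlim by (intro AE_I2)
        show "AE t in M. norm ((f (Y n) t - f z t) / (Y n - z)) \<le> g t / \<rho>" for n
          using lip[OF _ Y(1)[of n]] Y(2)[of n] by (intro AE_I2) (simp add: norm_divide pos_divide_le_eq)
      qed (use qmeas in auto)
      moreover have "(\<integral>t. (f (Y n) t - f z t) / (Y n - z) \<partial>M) =
          (integral\<^sup>L M (f (Y n)) - integral\<^sup>L M (f z)) / (Y n - z)" for n
        using int[OF Y(1)] int[of z] \<rho>pos by simp
      ultimately show "(\<lambda>n. (integral\<^sup>L M (f (X n)) - integral\<^sup>L M (f z)) / (X n - z)) \<longlonglongrightarrow> (\<integral>t. ?d t z \<partial>M)"
        unfolding Y_def by (intro LIMSEQ_offset[where k = N and f = "\<lambda>n. (integral\<^sup>L M (f (X n)) - integral\<^sup>L M (f z)) / (X n - z)"]) (simp only:)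
    qed
    then show ?thesis by (auto simp: has_field_derivative_iff)
  qed
  then show ?thesis using U by (auto simp: holomorphic_on_open)
qed

section \<open>Powers on a half-line\<close>

lemma norm_of_real_powr: "x > 0 \<Longrightarrow> norm (complex_of_real x powr z) = x powr Re z"
  by (simp add: norm_powr_real_powr)

lemma of_real_powr_eq_exp: "x > 0 \<Longrightarrow> complex_of_real x powr z = exp (z * of_real (ln x))"
  by (simp add: powr_def Ln_of_real)

text \<open>
  On the negative axis, which is the branch cut of the complex logarithm, continuity does not
  help, so the power is written out separately on each half of the real line.
\<close>

lemma borel_measurable_of_real_powr [measurable]:
  "(\<lambda>x. complex_of_real x powr z) \<in> borel_measurable borel"
proof -
  have "(\<lambda>x. complex_of_real x powr z) = (\<lambda>x. if x > 0 then exp (z * of_real (ln x)) else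
      if x = 0 then 0 else exp (z * (of_real (ln (- x)) + \<i> * pi)))"
  proof
    fix x :: real
    show "complex_of_real x powr z = (if x > 0 then exp (z * of_real (ln x)) else
      if x = 0 then 0 else exp (z * (of_real (ln (- x)) + \<i> * pi)))"
    proof (cases "x < 0")
      case True
      then have "Ln (complex_of_real x) = Ln (- complex_of_real (- x))" by simp
      also have "\<dots> = of_real (ln (- x)) + \<i> * pi"
        using True Ln_of_real[of "- x"] by (subst Ln_minus) auto
      finally show ?thesis using True by (simp add: powr_def)
    qed (auto simp: of_real_powr_eq_exp)
  qed
  also have "\<dots> \<in> borel_measurable borel" by measurable
  finally show ?thesis .
qed

lemma set_integrable_powr_atLeast:
  assumes "c > 0" "\<sigma> > 0"
  shows "set_integrable lborel {c..} (\<lambda>x::real. x powr (- \<sigma> - 1))"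
    and "(LBINT x:{c..}. x powr (- \<sigma> - 1)) = c powr (- \<sigma>) / \<sigma>"
proof -
  have I: "((\<lambda>x. x powr (- \<sigma> - 1)) has_integral c powr (- \<sigma>) / \<sigma>) {c..}"
    using has_integral_powr_to_inf[of "- \<sigma> - 1" c] assms by (simp add: field_simps)
  then have "(\<lambda>x. x powr (- \<sigma> - 1)) absolutely_integrable_on {c..}"
    by (intro nonnegative_absolutely_integrable_1) (auto simp: integrable_on_def)
  then show *: "set_integrable lborel {c..} (\<lambda>x::real. x powr (- \<sigma> - 1))"
    unfolding set_integrable_def by (subst (asm) integrable_completion) auto
  show "(LBINT x:{c..}. x powr (- \<sigma> - 1)) = c powr (- \<sigma>) / \<sigma>"
    using set_borel_integral_eq_integral(2)[OF *] I by (simp add: integral_unique)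
qed

text \<open>
  Integrability is that of the real power which is the norm of the integrand. The value comes from the
  antiderivative \<open>- x\<^sup>-\<^sup>w / w\<close> on \<open>[c, c + n]\<close>, whose upper end vanishes in the limit.
\<close>

lemma set_integrable_complex_powr_atLeast:
  assumes c: "c > 0" and w: "Re w > 0"
  shows "set_integrable lborel {c..} (\<lambda>x. complex_of_real x powr (- w - 1))"
    and "(CLBINT x:{c..}. complex_of_real x powr (- w - 1)) = complex_of_real c powr (- w) / w"
proof -
  show int: "set_integrable lborel {c..} (\<lambda>x. complex_of_real x powr (- w - 1))"
    using set_integrable_powr_atLeast(1)[OF c w] unfolding set_integrable_def
    by (rule Bochner_Integration.integrable_bound)
       (use c in \<open>auto simp: norm_of_real_powr indicator_def\<close>)
  let ?F = "\<lambda>x. - (complex_of_real x powr (- w)) / w"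
  have "w \<noteq> 0" using w by auto
  have FTC: "(CLBINT x:{c..c + real n}. complex_of_real x powr (- w - 1)) = ?F (c + real n) - ?F c" for n
  proof -
    have "((\<lambda>x. complex_of_real x powr (- w - 1)) has_integral ?F (c + real n) - ?F c) {c..c + real n}"
    proof (rule fundamental_theorem_of_calculus)
      fix x assume x: "x \<in> {c..c + real n}"
      then have "complex_of_real x \<notin> \<real>\<^sub>\<le>\<^sub>0" using c by auto
      then have "((\<lambda>z. - (z powr (- w)) / w) has_field_derivative of_real x powr (- w - 1)) (at (of_real x))"
        using \<open>w \<noteq> 0\<close> by (auto intro!: derivative_eq_intros has_field_derivative_powr simp: field_simps)
      then show "(?F has_vector_derivative of_real x powr (- w - 1)) (at x within {c..c + real n})"
        by (rule has_vector_derivative_real_field)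
    qed simp
    moreover have "set_integrable lborel {c..c + real n} (\<lambda>x. complex_of_real x powr (- w - 1))"
      by (rule set_integrable_subset[OF int]) auto
    ultimately show ?thesis
      using set_borel_integral_eq_integral(2) by (metis integral_unique)
  qed
  have un: "(\<Union>n. {c..c + real n}) = {c..}"
  proof (intro equalityI subsetI)
    fix x assume "x \<in> {c..}"
    moreover obtain n where "x - c \<le> real n" using real_arch_simple by blast
    ultimately show "x \<in> (\<Union>n. {c..c + real n})" by (auto intro!: exI[of _ n])
  qed auto
  have "(\<lambda>n. CLBINT x:{c..c + real n}. complex_of_real x powr (- w - 1)) \<longlonglongrightarrow>
      (CLBINT x:(\<Union>n. {c..c + real n}). complex_of_real x powr (- w - 1))"
    by (rule set_integral_cont_up) (auto simp: incseq_def un int)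
  then have lim1: "(\<lambda>n. ?F (c + real n) - ?F c) \<longlonglongrightarrow> (CLBINT x:{c..}. complex_of_real x powr (- w - 1))"
    by (simp only: FTC un)
  have "filterlim (\<lambda>n. c + real n) at_top sequentially"
    by (rule filterlim_tendsto_add_at_top[OF tendsto_const filterlim_real_sequentially])
  then have "(\<lambda>n. (c + real n) powr (- Re w)) \<longlonglongrightarrow> 0"
    using w by (intro tendsto_neg_powr) auto
  then have "(\<lambda>n. complex_of_real (c + real n) powr (- w)) \<longlonglongrightarrow> 0"
  proof (rule Lim_null_comparison[rotated])
    show "\<forall>\<^sub>F n in sequentially. norm (complex_of_real (c + real n) powr (- w)) \<le> (c + real n) powr (- Re w)"
      using c by (intro always_eventually allI, subst norm_of_real_powr) auto
  qed
  then have "(\<lambda>n. ?F (c + real n) - ?F c) \<longlonglongrightarrow> - 0 / w - ?F c"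
    by (intro tendsto_intros \<open>w \<noteq> 0\<close>)
  with lim1 show "(CLBINT x:{c..}. complex_of_real x powr (- w - 1)) = complex_of_real c powr (- w) / w"
    using LIMSEQ_unique by fastforce
qed

section \<open>Mellin transforms of contour integrals and of summatory functions\<close>

text \<open>
  The Mellin transform of \<open>x\<^sup>p\<close> at \<open>s\<close> is \<open>1/(s - p)\<close>. By Fubini's theorem the same holds under an average
  over exponents whose real parts stay to the left of, and away from, \<open>Re s\<close>.
  The exponents are constrained only on the support of the weight, so that a segment can be
  parametrised over all of \<open>\<real>\<close>, with a weight that vanishes outside \<open>[0, 1]\<close>.
\<close>

lemma mellin_superposition_of_powers:
  fixes w p :: "real \<Rightarrow> complex"
  assumes w: "integrable lborel w" and p [measurable]: "p \<in> borel_measurable lborel"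
    and Re_p: "\<And>t. w t \<noteq> 0 \<Longrightarrow> Re (p t) \<le> \<beta>" and s: "\<beta> < Re s"
  shows "mellin_abs_convergent (\<lambda>x. \<integral>t. w t * complex_of_real x powr p t \<partial>lborel) s"
    and "mellin_integral (\<lambda>x. \<integral>t. w t * complex_of_real x powr p t \<partial>lborel) s =
      (\<integral>t. w t / (s - p t) \<partial>lborel)"
proof -
  \<comment> \<open>The power is written with a logarithm to make joint measurability in \<open>t\<close> and \<open>x\<close> evident.\<close>
  let ?k = "\<lambda>t x. indicator {1::real..} x *\<^sub>R (w t * exp ((p t - s - 1) * complex_of_real (ln x)))"
  have [measurable]: "w \<in> borel_measurable lborel" using w by auto
  have meas: "case_prod ?k \<in> borel_measurable (lborel \<Otimes>\<^sub>M lborel)" by measurable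
  have k_eq: "?k t x = indicator {1..} x *\<^sub>R (w t * complex_of_real x powr (- (s - p t) - 1))" for t x
    by (auto simp: indicator_def of_real_powr_eq_exp algebra_simps)
  have k_eq': "?k t x = indicator {1..} x *\<^sub>R (w t * complex_of_real x powr p t * complex_of_real x powr (- s - 1))" for t x
    unfolding k_eq by (auto simp: indicator_def powr_add[symmetric] mult.assoc algebra_simps)
  have slice: "integrable lborel (?k t) \<and> (\<integral>x. ?k t x \<partial>lborel) = w t / (s - p t) \<and>
      (\<integral>x. norm (?k t x) \<partial>lborel) = norm (w t) / (Re s - Re (p t))" for t
  proof (cases "w t = 0")
    case False
    define v where "v = s - p t"
    have v: "Re v > 0" using Re_p[OF False] s by (simp add: v_def)
    have eq: "?k t x = w t * (indicator {1..} x *\<^sub>R complex_of_real x powr (- v - 1))" for x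
      unfolding k_eq v_def by simp
    have "integrable lborel (?k t)" unfolding eq
      using set_integrable_complex_powr_atLeast(1)[OF zero_less_one v]
      unfolding set_integrable_def by (rule integrable_mult_right)
    moreover have "(\<integral>x. ?k t x \<partial>lborel) = w t / v" unfolding eq
      using set_integrable_complex_powr_atLeast(2)[OF zero_less_one v]
      unfolding set_lebesgue_integral_def by (simp del: mult_scaleR_right)
    moreover have "(\<integral>x. norm (?k t x) \<partial>lborel) = norm (w t) / Re v"
    proof -
      have norm_eq: "norm (?k t x) = norm (w t) * (indicator {1..} x *\<^sub>R x powr (- Re v - 1))" for x
        unfolding eq by (auto simp: norm_mult indicator_def norm_of_real_powr)
      have "(\<integral>x. norm (?k t x) \<partial>lborel) = norm (w t) * (LBINT x:{1..}. x powr (- Re v - 1))"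
        unfolding norm_eq set_lebesgue_integral_def by (rule integral_mult_right_zero)
      then show ?thesis
        using set_integrable_powr_atLeast(2)[OF zero_less_one v] by simp
    qed
    ultimately show ?thesis by (simp add: v_def)
  qed simp
  have int: "integrable (lborel \<Otimes>\<^sub>M lborel) (case_prod ?k)"
  proof (rule lborel_pair.Fubini_integrable[OF meas])
    have "integrable lborel (\<lambda>t. norm (w t) / (Re s - Re (p t)))"
    proof (rule Bochner_Integration.integrable_bound)
      show "integrable lborel (\<lambda>t. norm (w t) / (Re s - \<beta>))" using w by simp
      show "AE t in lborel. norm (norm (w t) / (Re s - Re (p t))) \<le> norm (norm (w t) / (Re s - \<beta>))"
      proof (rule AE_I2)
        fix t
        show "norm (norm (w t) / (Re s - Re (p t))) \<le> norm (norm (w t) / (Re s - \<beta>))"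
          using Re_p[of t] s by (cases "w t = 0") (auto intro!: divide_left_mono mult_pos_pos)
      qed
    qed measurable
    then show "integrable lborel (\<lambda>t. \<integral>x. norm (case_prod ?k (t, x)) \<partial>lborel)"
      using slice by simp
    show "AE t in lborel. integrable lborel (\<lambda>x. case_prod ?k (t, x))"
      using slice by simp
  qed
  have inner: "(\<integral>t. ?k t x \<partial>lborel) = indicator {1..} x *\<^sub>R
      ((\<integral>t. w t * complex_of_real x powr p t \<partial>lborel) * complex_of_real x powr (- s - 1))" for x
    unfolding k_eq' by simp
  show "mellin_abs_convergent (\<lambda>x. \<integral>t. w t * complex_of_real x powr p t \<partial>lborel) s"
    using lborel_pair.integrable_snd[OF int]
    unfolding mellin_abs_convergent_def set_integrable_def inner .
  show "mellin_integral (\<lambda>x. \<integral>t. w t * complex_of_real x powr p t \<partial>lborel) s =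
      (\<integral>t. w t / (s - p t) \<partial>lborel)"
    using lborel_pair.Fubini_integral[OF int] slice
    unfolding mellin_integral_def set_lebesgue_integral_def inner by simp
qed

text \<open>
  Contour integrals are gauge integrals. Fubini's theorem and dominated convergence need them as
  Lebesgue integrals.
\<close>

lemma linepath_integral_eq_lebesgue_integral:
  assumes "continuous_on (closed_segment a b) f"
  shows "integrable lborel (\<lambda>t. indicator {0..1} t *\<^sub>R (f (linepath a b t) * (b - a)))"
    and "contour_integral (linepath a b) f =
      (\<integral>t. indicator {0..1} t *\<^sub>R (f (linepath a b t) * (b - a)) \<partial>lborel)"
proof -
  have "continuous_on {0..1} (\<lambda>t. f (linepath a b t))"
    by (rule continuous_on_compose2[OF assms]) (auto intro!: continuous_intros linepath_in_path)
  then have "continuous_on {0..1} (\<lambda>t. f (linepath a b t) * (b - a))"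
    by (intro continuous_intros)
  from borel_integrable_compact[OF _ this]
  show int: "integrable lborel (\<lambda>t. indicator {0..1} t *\<^sub>R (f (linepath a b t) * (b - a)))"
    by simp
  then have "(LINT t:{0..1}|lborel. f (linepath a b t) * (b - a)) =
      integral {0..1} (\<lambda>t. f (linepath a b t) * (b - a))"
    by (intro set_borel_integral_eq_integral(2)) (simp add: set_integrable_def)
  then show "contour_integral (linepath a b) f =
      (\<integral>t. indicator {0..1} t *\<^sub>R (f (linepath a b t) * (b - a)) \<partial>lborel)"
    by (simp only: contour_integral_integral vector_derivative_linepath_at set_lebesgue_integral_def)
qed

lemma mellin_linepath_integral:
  assumes g: "continuous_on (closed_segment a b) g"
    and Re_le: "Re a \<le> \<beta>" "Re b \<le> \<beta>" and s: "\<beta> < Re s"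
  shows "mellin_abs_convergent
      (\<lambda>x. contour_integral (linepath a b) (\<lambda>\<eta>. g \<eta> * complex_of_real x powr \<eta>)) s"
    and "mellin_integral
      (\<lambda>x. contour_integral (linepath a b) (\<lambda>\<eta>. g \<eta> * complex_of_real x powr \<eta>)) s =
        contour_integral (linepath a b) (\<lambda>\<eta>. g \<eta> / (s - \<eta>))"
proof -
  let ?w = "\<lambda>t. indicator {0..1} t *\<^sub>R (g (linepath a b t) * (b - a))"
  have Re_seg: "Re \<eta> \<le> \<beta>" if "\<eta> \<in> closed_segment a b" for \<eta>
  proof -
    have "Re ` closed_segment a b = closed_segment (Re a) (Re b)"
      by (rule closed_segment_linear_image[symmetric]) (rule bounded_linear.linear[OF bounded_linear_Re])
    moreover have "Re \<eta> \<in> Re ` closed_segment a b" using that by blast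
    ultimately show ?thesis using Re_le by (auto simp: closed_segment_eq_real_ivl split: if_splits)
  qed
  have wint: "integrable lborel ?w"
    by (rule linepath_integral_eq_lebesgue_integral(1)[OF g])
  have pmeas: "linepath a b \<in> borel_measurable lborel"
    unfolding linepath_def by measurable
  have Re_p: "Re (linepath a b t) \<le> \<beta>" if "?w t \<noteq> 0" for t
    using that by (intro Re_seg linepath_in_path) (auto simp: indicator_def split: if_splits)
  have 1: "contour_integral (linepath a b) (\<lambda>\<eta>. g \<eta> * complex_of_real x powr \<eta>) =
      (\<integral>t. ?w t * complex_of_real x powr (linepath a b t) \<partial>lborel)" if "x \<ge> 1" for x
  proof -
    have "continuous_on (closed_segment a b) (\<lambda>\<eta>. g \<eta> * complex_of_real x powr \<eta>)"
      using g that by (intro continuous_intros) auto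
    from linepath_integral_eq_lebesgue_integral(2)[OF this] show ?thesis
      by (auto intro!: Bochner_Integration.integral_cong simp: algebra_simps)
  qed
  have "s \<notin> closed_segment a b" using Re_seg s by force
  then have "continuous_on (closed_segment a b) (\<lambda>\<eta>. g \<eta> / (s - \<eta>))"
    using g by (intro continuous_intros) auto
  from linepath_integral_eq_lebesgue_integral(2)[OF this]
  have 2: "contour_integral (linepath a b) (\<lambda>\<eta>. g \<eta> / (s - \<eta>)) = (\<integral>t. ?w t / (s - linepath a b t) \<partial>lborel)"
    by (auto intro!: Bochner_Integration.integral_cong simp: indicator_def)
  show "mellin_abs_convergent
      (\<lambda>x. contour_integral (linepath a b) (\<lambda>\<eta>. g \<eta> * complex_of_real x powr \<eta>)) s"
    using mellin_superposition_of_powers(1)[OF wint pmeas Re_p s]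
    unfolding mellin_abs_convergent_def using 1 by (subst set_integrable_cong) auto
  show "mellin_integral
      (\<lambda>x. contour_integral (linepath a b) (\<lambda>\<eta>. g \<eta> * complex_of_real x powr \<eta>)) s =
        contour_integral (linepath a b) (\<lambda>\<eta>. g \<eta> / (s - \<eta>))"
    using mellin_superposition_of_powers(2)[OF wint pmeas Re_p s]
    unfolding 2 mellin_integral_def using 1 by (subst set_lebesgue_integral_cong) auto
qed

text \<open>
  Summation and integration are exchanged: the term \<open>a\<^sub>n\<close> contributes \<open>a\<^sub>n\<close> times the integral of \<open>x\<^sup>-\<^sup>s\<^sup>-\<^sup>1\<close> over
  \<open>[n, \<infinity>)\<close>, that is \<open>a\<^sub>n n\<^sup>-\<^sup>s / s\<close>. The halved last term of the starred sum occurs only at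
  integers, a null set.
\<close>

lemma mellin_starred_sum:
  assumes summ: "summable (\<lambda>n. norm (dirichlet_term a s (Suc n)))" and s: "Re s > 0"
  shows "mellin_abs_convergent (\<lambda>x. complex_of_real (starred_sum a x)) s"
    and "mellin_integral (\<lambda>x. complex_of_real (starred_sum a x)) s =
      (\<Sum>n. dirichlet_term a s (Suc n)) / s"
proof -
  let ?u = "\<lambda>n x. indicator {real (Suc n)..} x *\<^sub>R (complex_of_real (a (Suc n)) * complex_of_real x powr (- s - 1))"
  have u_eq: "?u n x = complex_of_real (a (Suc n)) * (indicator {real (Suc n)..} x *\<^sub>R complex_of_real x powr (- s - 1))" for n x
    by simp
  have u_int: "integrable lborel (?u n)" for n
    unfolding u_eq
    using set_integrable_complex_powr_atLeast(1)[of "real (Suc n)" s] s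
    unfolding set_integrable_def by (intro integrable_mult_right) simp
  have u_val: "(\<integral>x. ?u n x \<partial>lborel) = dirichlet_term a s (Suc n) / s" for n
    unfolding u_eq
    using set_integrable_complex_powr_atLeast(2)[of "real (Suc n)" s] s
    unfolding set_lebesgue_integral_def dirichlet_term_def by (simp del: mult_scaleR_right)
  have u_norm: "(\<integral>x. norm (?u n x) \<partial>lborel) = norm (dirichlet_term a s (Suc n)) / Re s" for n
  proof -
    have norm_eq: "norm (?u n x) = \<bar>a (Suc n)\<bar> * (indicator {real (Suc n)..} x *\<^sub>R x powr (- Re s - 1))" for x
      by (auto simp: norm_mult indicator_def norm_of_real_powr)
    have "(\<integral>x. norm (?u n x) \<partial>lborel) = \<bar>a (Suc n)\<bar> * (LBINT x:{real (Suc n)..}. x powr (- Re s - 1))"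
      unfolding norm_eq set_lebesgue_integral_def by (rule integral_mult_right_zero)
    then show ?thesis
      using set_integrable_powr_atLeast(2)[of "real (Suc n)" "Re s"] s norm_of_real_powr[of "real (Suc n)" "- s"]
      unfolding dirichlet_term_def by (simp add: norm_mult)
  qed
  have fin: "finite {n. real (Suc n) \<le> x}" for x
    by (rule finite_subset[of _ "{..nat \<lfloor>x\<rfloor>}"]) (auto simp: le_nat_iff le_floor_iff)
  have u_fin: "?u n x = 0" if "n \<notin> {n. real (Suc n) \<le> x}" for n x
    using that by (auto simp: indicator_def)
  have u_summable: "summable (\<lambda>n. norm (?u n x))" for x
    by (rule summable_finite[OF fin[of x]]) (use u_fin in auto)
  have norm_summable: "summable (\<lambda>n. \<integral>x. norm (?u n x) \<partial>lborel)"
    unfolding u_norm using summ by (rule summable_divide)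
  let ?S = "\<lambda>x. \<Sum>n. ?u n x"
  have S_int: "integrable lborel ?S"
    by (rule integrable_suminf[OF u_int]) (use u_summable norm_summable in auto)
  have S_val: "(\<integral>x. ?S x \<partial>lborel) = (\<Sum>n. dirichlet_term a s (Suc n)) / s"
  proof -
    have "(\<integral>x. ?S x \<partial>lborel) = (\<Sum>n. dirichlet_term a s (Suc n) / s)"
      unfolding u_val[symmetric]
      by (rule integral_suminf[OF u_int]) (use u_summable norm_summable in auto)
    then show ?thesis using summ by (simp add: suminf_divide summable_norm_cancel)
  qed
  let ?f = "\<lambda>x. indicator {1..} x *\<^sub>R (complex_of_real (starred_sum a x) * complex_of_real x powr (- s - 1))"
  have S_eq: "?S x = ?f x" if "x \<notin> \<nat>" for x
  proof -
    have "?S x = (\<Sum>n\<in>{n. real (Suc n) \<le> x}. ?u n x)"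
      by (rule suminf_finite[OF fin]) (use u_fin in auto)
    also have "\<dots> = (\<Sum>n\<in>{n. real (Suc n) \<le> x}. complex_of_real (a (Suc n)) * complex_of_real x powr (- s - 1))"
      by (intro sum.cong) auto
    also have "\<dots> = complex_of_real (\<Sum>n\<in>{n. real (Suc n) \<le> x}. a (Suc n)) * complex_of_real x powr (- s - 1)"
      by (simp add: sum_distrib_right)
    also have "(\<Sum>n\<in>{n. real (Suc n) \<le> x}. a (Suc n)) = (\<Sum>n | 1 \<le> n \<and> real n \<le> x. a n)"
      by (rule sum.reindex_bij_witness[of _ "\<lambda>n. n - 1" Suc]) auto
    also have "complex_of_real \<dots> * complex_of_real x powr (- s - 1) = ?f x"
    proof (cases "x \<ge> 1")
      case False
      then have "{n. 1 \<le> n \<and> real n \<le> x} = {}" by auto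
      then have "(\<Sum>n | 1 \<le> n \<and> real n \<le> x. a n) = 0" by (simp only: sum.empty)
      with False show ?thesis by (simp only: of_real_0) simp
    qed (use that in \<open>simp add: starred_sum_def\<close>)
    finally show ?thesis .
  qed
  have nat: "countable (\<nat> :: real set)" by (simp add: Nats_def)
  show "mellin_abs_convergent (\<lambda>x. complex_of_real (starred_sum a x)) s"
    unfolding mellin_abs_convergent_def set_integrable_def
    using S_int integrable_discrete_difference[OF nat, of lborel ?S ?f] S_eq by simp
  show "mellin_integral (\<lambda>x. complex_of_real (starred_sum a x)) s =
      (\<Sum>n. dirichlet_term a s (Suc n)) / s"
    unfolding mellin_integral_def set_lebesgue_integral_def
    using S_val integral_discrete_difference[OF nat, of lborel ?S ?f] S_eq by simp
qed

section \<open>Linearity and regularity of the Mellin integral\<close>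

definition has_mellin :: "(real \<Rightarrow> complex) \<Rightarrow> complex \<Rightarrow> complex \<Rightarrow> bool" where
  "has_mellin F s v \<longleftrightarrow> mellin_abs_convergent F s \<and> mellin_integral F s = v"

lemma has_mellin_diff:
  assumes "has_mellin F s u" "has_mellin G s v"
  shows "has_mellin (\<lambda>x. F x - G x) s (u - v)"
  using assms unfolding has_mellin_def mellin_abs_convergent_def mellin_integral_def
  by (simp add: left_diff_distrib set_integral_diff)

lemma has_mellin_add:
  assumes "has_mellin F s u" "has_mellin G s v"
  shows "has_mellin (\<lambda>x. F x + G x) s (u + v)"
  using assms unfolding has_mellin_def mellin_abs_convergent_def mellin_integral_def
  by (simp add: distrib_right set_integral_add)

lemma has_mellin_cmult:
  assumes "has_mellin F s u"
  shows "has_mellin (\<lambda>x. c * F x) s (c * u)"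
  using assms unfolding has_mellin_def mellin_abs_convergent_def mellin_integral_def
  by (simp add: mult.assoc)

lemma has_mellin_cong:
  assumes "\<And>x. x \<ge> 1 \<Longrightarrow> F x = G x"
  shows "has_mellin F s u \<longleftrightarrow> has_mellin G s u"
proof -
  have "set_integrable lborel {1..} (\<lambda>x. F x * complex_of_real x powr (- s - 1)) =
      set_integrable lborel {1..} (\<lambda>x. G x * complex_of_real x powr (- s - 1))"
    by (intro set_integrable_cong) (use assms in auto)
  moreover have "(LINT x:{1..}|lborel. F x * complex_of_real x powr (- s - 1)) =
      (LINT x:{1..}|lborel. G x * complex_of_real x powr (- s - 1))"
    by (intro set_lebesgue_integral_cong) (use assms in auto)
  ultimately show ?thesis
    unfolding has_mellin_def mellin_abs_convergent_def mellin_integral_def by (simp only:)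
qed

text \<open>
  Everything about the dependence of the Mellin integrand on \<open>s\<close> follows from this: moving from
  \<open>s0\<close> to \<open>s\<close> multiplies it by a power of norm at most 1 when \<open>Re s \<ge> Re s0\<close>.
\<close>

lemma mellin_integrand_shift:
  "indicator {1..} x *\<^sub>R (F x * complex_of_real x powr (- s - 1)) =
    (indicator {1..} x *\<^sub>R (F x * complex_of_real x powr (- s0 - 1))) * complex_of_real x powr (s0 - s)"
  by (auto simp: indicator_def powr_add[symmetric] mult.assoc algebra_simps)

lemma norm_mellin_integrand_le:
  assumes "Re s \<ge> Re s0"
  shows "norm (indicator {1..} x *\<^sub>R (F x * complex_of_real x powr (- s - 1))) \<le>
    norm (indicator {1..} x *\<^sub>R (F x * complex_of_real x powr (- s0 - 1)))"
proof (cases "x \<ge> 1")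
  case True
  then have "norm (complex_of_real x powr (s0 - s)) \<le> 1"
    using assms powr_mono[of "Re s0 - Re s" 0 x] by (simp add: norm_of_real_powr)
  then show ?thesis
    unfolding mellin_integrand_shift[where s = s and ?s0.0 = s0] norm_mult[of _ "complex_of_real x powr (s0 - s)"]
    by (intro mult_right_le_one_le) auto
qed simp

lemma mellin_integrand_measurable:
  assumes "mellin_abs_convergent F s0"
  shows "(\<lambda>x. indicator {1..} x *\<^sub>R (F x * complex_of_real x powr (- s - 1))) \<in> borel_measurable lborel"
proof -
  have "(\<lambda>x. indicator {1..} x *\<^sub>R (F x * complex_of_real x powr (- s0 - 1))) \<in> borel_measurable lborel"
    using assms by (auto simp: mellin_abs_convergent_def set_integrable_def)
  moreover have "(\<lambda>x. complex_of_real x powr (s0 - s)) \<in> borel_measurable lborel"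
    by simp
  ultimately show ?thesis
    unfolding mellin_integrand_shift[where s = s and ?s0.0 = s0] by (rule borel_measurable_times)
qed

lemma mellin_integral_holomorphic:
  assumes "mellin_abs_convergent F s0"
  shows "mellin_integral F holomorphic_on {s. Re s > Re s0}"
  unfolding mellin_integral_def set_lebesgue_integral_def
proof (rule holomorphic_on_lebesgue_integral)
  show "open {s. Re s > Re s0}" by (rule open_halfspace_Re_gt)
  show "(\<lambda>z. indicator {1..} x *\<^sub>R (F x * complex_of_real x powr (- z - 1))) holomorphic_on {s. Re s > Re s0}" for x
  proof (cases "x \<ge> 1")
    case True
    then show ?thesis by (auto intro!: holomorphic_intros simp: indicator_def)
  qed auto
  let ?g = "\<lambda>x. norm (indicator {1..} x *\<^sub>R (F x * complex_of_real x powr (- s0 - 1)))"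
  have "integrable lborel ?g"
    using assms unfolding mellin_abs_convergent_def set_integrable_def by (rule integrable_norm)
  then show "\<exists>r>0. \<exists>g. integrable lborel g \<and> (\<forall>w\<in>ball z r \<inter> {s. Re s > Re s0}. \<forall>x\<in>space lborel.
      norm (indicator {1..} x *\<^sub>R (F x * complex_of_real x powr (- w - 1))) \<le> g x)" for z
    using norm_mellin_integrand_le by (intro exI[of _ 1] conjI exI[of _ ?g]) (auto simp del: norm_scaleR)
qed (rule mellin_integrand_measurable[OF assms])

lemma tendsto_add_inverse_Suc:
  "(\<lambda>n. s + complex_of_real (1 / real (Suc n))) \<longlonglongrightarrow> s"
proof -
  have "(\<lambda>n. complex_of_real (1 / real (Suc n))) \<longlonglongrightarrow> complex_of_real 0"
    by (intro tendsto_of_real LIMSEQ_Suc[OF lim_1_over_n])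
  then have "(\<lambda>n. s + complex_of_real (1 / real (Suc n))) \<longlonglongrightarrow> s + complex_of_real 0"
    by (rule tendsto_add[OF tendsto_const])
  then show ?thesis by simp
qed

text \<open>
  The Mellin integral may converge absolutely at \<open>s0\<close> without being defined in a neighbourhood. It is
  still continuous there from the right.
\<close>

lemma mellin_integral_tendsto_right:
  assumes "mellin_abs_convergent F s0"
  shows "(\<lambda>n. mellin_integral F (s0 + of_real (1 / real (Suc n)))) \<longlonglongrightarrow> mellin_integral F s0"
  unfolding mellin_integral_def set_lebesgue_integral_def
proof (rule integral_dominated_convergence)
  let ?g = "\<lambda>x. norm (indicator {1..} x *\<^sub>R (F x * complex_of_real x powr (- s0 - 1)))"
  show "integrable lborel ?g"
    using assms unfolding mellin_abs_convergent_def set_integrable_def by (rule integrable_norm)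
  show "AE x in lborel. norm (indicator {1..} x *\<^sub>R (F x * complex_of_real x powr (- (s0 + of_real (1 / real (Suc n))) - 1))) \<le> ?g x" for n
    by (intro AE_I2 norm_mellin_integrand_le) simp
  show "AE x in lborel. (\<lambda>n. indicator {1..} x *\<^sub>R (F x * complex_of_real x powr (- (s0 + of_real (1 / real (Suc n))) - 1))) \<longlonglongrightarrow>
      indicator {1..} x *\<^sub>R (F x * complex_of_real x powr (- s0 - 1))"
  proof (rule AE_I2)
    fix x :: real
    show "(\<lambda>n. indicator {1..} x *\<^sub>R (F x * complex_of_real x powr (- (s0 + of_real (1 / real (Suc n))) - 1))) \<longlonglongrightarrow>
      indicator {1..} x *\<^sub>R (F x * complex_of_real x powr (- s0 - 1))"
    proof (cases "x \<ge> 1")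
      case True
      have "isCont (\<lambda>z. indicator {1..} x *\<^sub>R (F x * complex_of_real x powr (- z - 1))) s0"
        using True by (intro continuous_intros) auto
      then show ?thesis by (rule isCont_tendsto_compose[OF _ tendsto_add_inverse_Suc])
    qed simp
  qed
qed (rule mellin_integrand_measurable[OF assms])+

section \<open>The sides of the rectangle\<close>

lemma contour_integral_rectpath:
  fixes f :: "complex \<Rightarrow> complex"
  assumes f: "continuous_on (path_image (rectpath (Complex l b) (Complex r t))) f"
  shows "contour_integral (rectpath (Complex l b) (Complex r t)) f =
    contour_integral (linepath (Complex l b) (Complex r b)) f +
    contour_integral (linepath (Complex r b) (Complex r t)) f -
    contour_integral (linepath (Complex l t) (Complex r t)) f -
    contour_integral (linepath (Complex l b) (Complex l t)) f"
proof -
  have img: "path_image (rectpath (Complex l b) (Complex r t)) =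
      closed_segment (Complex l b) (Complex r b) \<union> closed_segment (Complex r b) (Complex r t) \<union>
      closed_segment (Complex r t) (Complex l t) \<union> closed_segment (Complex l t) (Complex l b)"
    by (simp add: rectpath_def Let_def path_image_join Un_assoc)
  have c: "continuous_on (closed_segment (Complex l b) (Complex r b)) f"
      "continuous_on (closed_segment (Complex r b) (Complex r t)) f"
      "continuous_on (closed_segment (Complex r t) (Complex l t)) f"
      "continuous_on (closed_segment (Complex l t) (Complex l b)) f"
    using f continuous_on_subset unfolding img by blast+
  have "contour_integral (rectpath (Complex l b) (Complex r t)) f =
    contour_integral (linepath (Complex l b) (Complex r b)) f +
    (contour_integral (linepath (Complex r b) (Complex r t)) f +
    (contour_integral (linepath (Complex r t) (Complex l t)) f +
    contour_integral (linepath (Complex l t) (Complex l b)) f))"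
    using c[THEN contour_integrable_continuous_linepath]
    by (simp add: rectpath_def Let_def contour_integrable_joinI valid_path_join)
  also have "contour_integral (linepath (Complex r t) (Complex l t)) f = - contour_integral (linepath (Complex l t) (Complex r t)) f"
    by (rule contour_integral_reverse_linepath[OF c(3)])
  also have "contour_integral (linepath (Complex l t) (Complex l b)) f = - contour_integral (linepath (Complex l b) (Complex l t)) f"
    by (rule contour_integral_reverse_linepath[OF c(4)])
  finally show ?thesis by simp
qed

lemma contour_integral_bounded_part:
  fixes f :: "complex \<Rightarrow> complex"
  assumes f: "continuous_on (path_image (bounded_part \<sigma>1 \<sigma>3 T)) f"
  shows "f contour_integrable_on bounded_part \<sigma>1 \<sigma>3 T"
    and "contour_integral (bounded_part \<sigma>1 \<sigma>3 T) f =
      - contour_integral (linepath (Complex \<sigma>1 (- T)) (Complex \<sigma>3 (- T))) f +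
      contour_integral (linepath (Complex \<sigma>1 (- T)) (Complex \<sigma>1 T)) f +
      contour_integral (linepath (Complex \<sigma>1 T) (Complex \<sigma>3 T)) f"
proof -
  have img: "path_image (bounded_part \<sigma>1 \<sigma>3 T) =
      closed_segment (Complex \<sigma>3 (- T)) (Complex \<sigma>1 (- T)) \<union> closed_segment (Complex \<sigma>1 (- T)) (Complex \<sigma>1 T) \<union>
      closed_segment (Complex \<sigma>1 T) (Complex \<sigma>3 T)"
    by (simp add: bounded_part_def path_image_join Un_assoc)
  have c: "continuous_on (closed_segment (Complex \<sigma>3 (- T)) (Complex \<sigma>1 (- T))) f"
      "continuous_on (closed_segment (Complex \<sigma>1 (- T)) (Complex \<sigma>1 T)) f"
      "continuous_on (closed_segment (Complex \<sigma>1 T) (Complex \<sigma>3 T)) f"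
    using f continuous_on_subset unfolding img by blast+
  note ci = c[THEN contour_integrable_continuous_linepath]
  show "f contour_integrable_on bounded_part \<sigma>1 \<sigma>3 T"
    unfolding bounded_part_def by (intro contour_integrable_joinI ci valid_path_join) auto
  have "contour_integral (bounded_part \<sigma>1 \<sigma>3 T) f =
      contour_integral (linepath (Complex \<sigma>3 (- T)) (Complex \<sigma>1 (- T))) f +
      (contour_integral (linepath (Complex \<sigma>1 (- T)) (Complex \<sigma>1 T)) f +
      contour_integral (linepath (Complex \<sigma>1 T) (Complex \<sigma>3 T)) f)"
    using ci by (simp add: bounded_part_def contour_integrable_joinI valid_path_join)
  also have "contour_integral (linepath (Complex \<sigma>3 (- T)) (Complex \<sigma>1 (- T))) f =
      - contour_integral (linepath (Complex \<sigma>1 (- T)) (Complex \<sigma>3 (- T))) f"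
    by (rule contour_integral_reverse_linepath[OF c(1)])
  finally show "contour_integral (bounded_part \<sigma>1 \<sigma>3 T) f =
      - contour_integral (linepath (Complex \<sigma>1 (- T)) (Complex \<sigma>3 (- T))) f +
      contour_integral (linepath (Complex \<sigma>1 (- T)) (Complex \<sigma>1 T)) f +
      contour_integral (linepath (Complex \<sigma>1 T) (Complex \<sigma>3 T)) f" by simp
qed

section \<open>Cauchy kernels along segments and vertical lines\<close>

text \<open>
  The two factors \<open>\<eta>\<close> and \<open>z - \<eta>\<close> of the kernel's denominator together give quadratic decay along a
  vertical line, with a constant that depends only on an upper bound for the norm of \<open>z\<close> and a lower bound for its
  distance to \<open>\<eta>\<close>. It is therefore uniform for \<open>z\<close> in a small disc.
\<close>

lemma vertical_kernel_bound:
  assumes c: "c > 0" and d: "d > 0" "d \<le> norm (z - Complex c t)" and B: "norm z \<le> B"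
  shows "1 / (norm (Complex c t) * norm (z - Complex c t)) \<le> (1 + 1 / c\<^sup>2) * (1 + B / d) * inverse (1 + t\<^sup>2)"
proof -
  have pos: "norm (Complex c t) > 0" "norm (z - Complex c t) > 0"
    using c d by (auto simp: complex_eq_iff)
  \<comment> \<open>As \<open>d\<close> is a lower bound for \<open>norm (z - Complex c t)\<close>, \<open>norm z\<close> is at most \<open>B/d\<close> times that norm.\<close>
  have le: "norm (Complex c t) \<le> norm (z - Complex c t) * (1 + B / d)"
  proof -
    have "norm (Complex c t) \<le> norm (z - Complex c t) + norm z"
      by (metis add.commute norm_minus_commute norm_triangle_sub)
    moreover have "norm z \<le> norm (z - Complex c t) * (B / d)"
    proof -
      have "B = d * (B / d)" using d by simp
      also have "\<dots> \<le> norm (z - Complex c t) * (B / d)"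
        using d order_trans[OF norm_ge_zero B] by (intro mult_right_mono) auto
      finally show ?thesis using B by simp
    qed
    ultimately show ?thesis by (simp add: algebra_simps)
  qed
  \<comment> \<open>The right-hand side exceeds the left-hand side by \<open>c\<^sup>2 + t\<^sup>2 / c\<^sup>2\<close>.\<close>
  have "1 + t\<^sup>2 \<le> (1 + 1 / c\<^sup>2) * (c\<^sup>2 + t\<^sup>2)"
    using c by (simp add: field_simps)
  also have "c\<^sup>2 + t\<^sup>2 = norm (Complex c t) * norm (Complex c t)"
    by (simp add: cmod_def power2_eq_square[symmetric] del: real_sqrt_mult)
  also have "(1 + 1 / c\<^sup>2) * (norm (Complex c t) * norm (Complex c t)) \<le>
      (1 + 1 / c\<^sup>2) * (norm (Complex c t) * (norm (z - Complex c t) * (1 + B / d)))"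
    by (intro mult_left_mono le) auto
  finally have "1 + t\<^sup>2 \<le> (1 + 1 / c\<^sup>2) * (1 + B / d) * (norm (Complex c t) * norm (z - Complex c t))"
    by (simp only: mult_ac)
  then show ?thesis using pos by (simp add: field_simps add_pos_nonneg)
qed

text \<open>
  Near a point at distance \<open>e\<close> from the values of \<open>p\<close> on the support of \<open>w\<close>, the integrand is dominated by \<open>2 |w| / e\<close>.
\<close>

lemma cauchy_transform_holomorphic:
  fixes w p :: "real \<Rightarrow> complex"
  assumes w: "integrable lborel w" and p [measurable]: "p \<in> borel_measurable lborel"
    and U: "open U" and disj: "\<And>t. w t \<noteq> 0 \<Longrightarrow> p t \<notin> U"
  shows "(\<lambda>z. \<integral>t. w t / (z - p t) \<partial>lborel) holomorphic_on U"
proof (rule holomorphic_on_lebesgue_integral[OF U])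
  have [measurable]: "w \<in> borel_measurable lborel" using w by auto
  show "(\<lambda>t. w t / (z - p t)) \<in> borel_measurable lborel" for z by measurable
  show "(\<lambda>z. w t / (z - p t)) holomorphic_on U" for t
    using disj[of t] by (cases "w t = 0") (auto intro!: holomorphic_intros)
  fix z assume "z \<in> U"
  then obtain e where e: "e > 0" "ball z e \<subseteq> U" using U open_contains_ball by blast
  have "norm (w t / (y - p t)) \<le> norm (w t) / (e / 2)" if y: "y \<in> ball z (e / 2)" for y t
  proof (cases "w t = 0")
    case False
    then have "p t \<notin> ball z e" using disj e by blast
    then have "e / 2 \<le> norm (y - p t)"
      using y dist_triangle[of z "p t" y] by (simp add: dist_norm)
    then show ?thesis unfolding norm_divide using e by (intro frac_le) auto
  qed simp
  then show "\<exists>r>0. \<exists>g. integrable lborel g \<and> (\<forall>y\<in>ball z r \<inter> U. \<forall>t\<in>space lborel. norm (w t / (y - p t)) \<le> g t)"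
    using e w by (intro exI[of _ "e / 2"] conjI exI[of _ "\<lambda>t. norm (w t) / (e / 2)"]) auto
qed

lemma linepath_cauchy_transform_holomorphic:
  assumes g: "continuous_on (closed_segment a b) g"
    and U: "open U" "closed_segment a b \<inter> U = {}"
  shows "(\<lambda>z. contour_integral (linepath a b) (\<lambda>\<eta>. g \<eta> / (z - \<eta>))) holomorphic_on U"
proof -
  let ?w = "\<lambda>t. indicator {0..1} t *\<^sub>R (g (linepath a b t) * (b - a))"
  have "(\<lambda>z. \<integral>t. ?w t / (z - linepath a b t) \<partial>lborel) holomorphic_on U"
  proof (rule cauchy_transform_holomorphic[OF linepath_integral_eq_lebesgue_integral(1)[OF g] _ U(1)])
    show "linepath a b \<in> borel_measurable lborel" unfolding linepath_def by measurable
    show "linepath a b t \<notin> U" if "?w t \<noteq> 0" for t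
    proof -
      have "linepath a b t \<in> closed_segment a b"
        using that by (intro linepath_in_path) (auto simp: indicator_def split: if_splits)
      then show ?thesis using U by blast
    qed
  qed
  moreover have "contour_integral (linepath a b) (\<lambda>\<eta>. g \<eta> / (z - \<eta>)) = (\<integral>t. ?w t / (z - linepath a b t) \<partial>lborel)"
    if "z \<in> U" for z
  proof -
    have "z \<notin> closed_segment a b" using U that by blast
    then have "continuous_on (closed_segment a b) (\<lambda>\<eta>. g \<eta> / (z - \<eta>))"
      using g by (intro continuous_intros) auto
    from linepath_integral_eq_lebesgue_integral(2)[OF this] show ?thesis
      by (auto intro!: Bochner_Integration.integral_cong simp: indicator_def)
  qed
  ultimately show ?thesis by (subst holomorphic_cong[OF refl]) auto
qed

lemma integrable_inverse_one_plus_square: "integrable lborel (\<lambda>t::real. inverse (1 + t\<^sup>2))"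
  using integrable_inverse_1_plus_square by (simp add: set_integrable_def)

lemma continuous_on_Complex_line: "continuous_on A (Complex c)"
  by (intro continuous_on_Complex continuous_intros)

lemma measurable_Complex_line [measurable]: "Complex c \<in> borel_measurable borel"
  by (intro borel_measurable_continuous_onI continuous_on_Complex_line)

text \<open>
  The half-lines of the contour are unbounded, and mere boundedness of \<open>D\<close> does not make \<open>D(\<eta>)/\<eta>\<close> integrable along
  them, so the decay of \<open>1/(z - \<eta>)\<close> has to be used as well.
\<close>

lemma vertical_line_kernel:
  fixes f :: "complex \<Rightarrow> complex"
  assumes c: "c > 0" and T [measurable]: "T \<in> sets borel"
    and cont: "continuous_on UNIV (\<lambda>t. f (Complex c t))"
    and K: "\<And>t. norm (f (Complex c t)) \<le> K"
    and U: "open U" and disj: "\<And>t. t \<in> T \<Longrightarrow> Complex c t \<notin> U"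
  shows "z \<in> U \<Longrightarrow> set_integrable lborel T (\<lambda>t. f (Complex c t) / (Complex c t * (z - Complex c t)))"
    and "(\<lambda>z. LINT t:T|lborel. f (Complex c t) / (Complex c t * (z - Complex c t))) holomorphic_on U"
proof -
  let ?h = "\<lambda>z t. indicator T t *\<^sub>R (f (Complex c t) / (Complex c t * (z - Complex c t)))"
  have [measurable]: "(\<lambda>t. f (Complex c t)) \<in> borel_measurable borel"
    using cont by (rule borel_measurable_continuous_onI)
  have [measurable]: "(\<lambda>t. Complex c t) \<in> borel_measurable borel"
    by (rule measurable_Complex_line)
  have meas: "?h z \<in> borel_measurable lborel" for z by measurable
  have K0: "K \<ge> 0" using K[of 0] norm_ge_zero order_trans by blast
  have dom: "\<exists>r>0. \<exists>g. integrable lborel g \<and> (\<forall>y\<in>ball z r \<inter> U. \<forall>t\<in>space lborel. norm (?h y t) \<le> g t)"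
    if z: "z \<in> U" for z
  proof -
    obtain e where e: "e > 0" "ball z e \<subseteq> U" using U z open_contains_ball by blast
    define r where "r = e / 2"
    have r: "r > 0" using e by (simp add: r_def)
    let ?g = "\<lambda>t. K * ((1 + 1 / c\<^sup>2) * (1 + (norm z + r) / r) * inverse (1 + t\<^sup>2))"
    have "norm (?h y t) \<le> ?g t" if y: "y \<in> ball z r" for y t
    proof (cases "t \<in> T")
      case True
      have "Complex c t \<notin> ball z e" using disj[OF True] e by blast
      then have d: "r \<le> norm (y - Complex c t)"
        using y dist_triangle[of z "Complex c t" y] by (simp add: r_def dist_norm)
      have B: "norm y \<le> norm z + r"
        using y norm_triangle_sub[of y z] by (simp add: dist_norm norm_minus_commute)
      have "norm (?h y t) = norm (f (Complex c t)) * (1 / (norm (Complex c t) * norm (y - Complex c t)))"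
        using True by (simp add: norm_divide norm_mult)
      also have "\<dots> \<le> ?g t"
        by (intro mult_mono K vertical_kernel_bound c r d B K0) simp
      finally show ?thesis .
    next
      case False
      then show ?thesis using K0 r by (simp add: add_nonneg_nonneg)
    qed
    moreover have "integrable lborel ?g"
      by (intro integrable_mult_right integrable_inverse_one_plus_square)
    ultimately show ?thesis using r by blast
  qed
  show "set_integrable lborel T (\<lambda>t. f (Complex c t) / (Complex c t * (z - Complex c t)))" if z: "z \<in> U"
  proof -
    obtain r g where r: "r > 0" "integrable lborel g" "\<And>y t. y \<in> ball z r \<inter> U \<Longrightarrow> norm (?h y t) \<le> g t"
      using dom[OF z] by auto
    have "norm (?h z t) \<le> norm (g t)" for t
      using r(3)[of z t] r(1) z by simp
    then show ?thesis unfolding set_integrable_def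
      by (intro Bochner_Integration.integrable_bound[OF r(2) meas] AE_I2)
  qed
  show "(\<lambda>z. LINT t:T|lborel. f (Complex c t) / (Complex c t * (z - Complex c t))) holomorphic_on U"
    unfolding set_lebesgue_integral_def
  proof (rule holomorphic_on_lebesgue_integral[OF U meas])
    show "(\<lambda>z. ?h z t) holomorphic_on U" for t
    proof (cases "t \<in> T")
      case True
      have "Complex c t \<noteq> 0" using c by (auto simp: complex_eq_iff)
      moreover have "z - Complex c t \<noteq> 0" if "z \<in> U" for z
        using disj[OF True] that by auto
      ultimately show ?thesis using True by (auto intro!: holomorphic_intros)
    qed auto
  qed (use dom in auto)
qed

lemma vertical_linepath_integral:
  assumes "T > 0" "set_integrable lborel {- T..T} (\<lambda>t. f (Complex c t))"
  shows "contour_integral (linepath (Complex c (- T)) (Complex c T)) f =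
    \<i> * (LINT t:{- T..T}|lborel. f (Complex c t))"
  using contour_integral_linepath_same_Re[of "Complex c (- T)" c "Complex c T" "- T" T f]
    set_borel_integral_eq_integral(2)[OF assms(2)] assms(1) by simp

text \<open>
  Cauchy's formula on the rectangle with corners \<open>c - \<i> n\<close> and \<open>c + n + \<i> n\<close>. On its three sides away from
  the line the kernel is \<open>O(n\<^sup>-\<^sup>2)\<close> and their length is \<open>O(n)\<close>, so only the line survives
  as \<open>n\<close> grows. Two signs cancel: the factor is \<open>1/(s - \<eta>)\<close> instead of \<open>1/(\<eta> - s)\<close>, and the
  line is traversed upwards, against the orientation of the rectangle.
\<close>

lemma vertical_line_cauchy_formula:
  fixes f :: "complex \<Rightarrow> complex"
  assumes holo: "f holomorphic_on {s. Re s > b}" and b: "0 \<le> b" "b < c"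
    and K: "\<And>\<eta>. Re \<eta> \<ge> c \<Longrightarrow> norm (f \<eta>) \<le> K" and s: "Re s > c"
  shows "set_integrable lborel UNIV (\<lambda>t. f (Complex c t) / (Complex c t * (s - Complex c t)))"
    and "(LINT t:UNIV|lborel. f (Complex c t) / (Complex c t * (s - Complex c t))) = 2 * of_real pi * f s / s"
proof -
  let ?h = "\<lambda>\<eta>. f \<eta> / (\<eta> * (s - \<eta>))"
  have fcont: "continuous_on {s. Re s > b} f" using holo by (rule holomorphic_on_imp_continuous_on)
  have lcont: "continuous_on UNIV (\<lambda>t. f (Complex c t))"
    by (rule continuous_on_compose2[OF fcont continuous_on_Complex_line]) (use b in auto)
  show int: "set_integrable lborel UNIV (\<lambda>t. ?h (Complex c t))"
    by (rule vertical_line_kernel(1)[where U = "{s. Re s > c}" and K = K])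
       (use b K lcont s open_halfspace_Re_gt in auto)
  have K0: "K \<ge> 0" using order_trans[OF norm_ge_zero K[of "of_real c"]] by simp
  have main: "norm (\<i> * (LINT t:{- real n..real n}|lborel. ?h (Complex c t)) - 2 * of_real pi * \<i> * (f s / s))
      \<le> 4 * K / (real n - norm s)" if n: "real n > norm s" for n :: nat
  proof -
    define N where "N = real n"
    have N: "N > norm s" "N > 0" using n norm_ge_zero[of s] unfolding N_def by linarith+
    have abs: "\<bar>Re s\<bar> < N" "\<bar>Im s\<bar> < N" using abs_Re_le_cmod[of s] abs_Im_le_cmod[of s] N by auto
    let ?a = "Complex c (- N)" let ?b = "Complex (c + N) N"
    let ?r = "rectpath ?a ?b"
    have img: "path_image ?r = {z. Re z \<in> {c, c + N} \<and> Im z \<in> {- N..N}} \<union> {z. Im z \<in> {- N, N} \<and> Re z \<in> {c..c + N}}"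
      using N by (subst path_image_rectpath) auto
    have sub: "path_image ?r \<subseteq> {z. Re z > b} - {s}"
      unfolding img using b s abs N by auto
    have "((\<lambda>w. (f w / w) / (w - s)) has_contour_integral (2 * pi * \<i> * winding_number ?r s * (f s / s))) ?r"
    proof (rule Cauchy_integral_formula_convex_simple[where S = "{z. Re z > b}"])
      show "(\<lambda>w. f w / w) holomorphic_on {z. Re z > b}"
        using holo b by (auto intro!: holomorphic_intros)
      show "s \<in> interior {z. Re z > b}"
        using s b by (subst interior_open) (auto simp: open_halfspace_Re_gt)
    qed (use sub in \<open>auto simp: convex_halfspace_Re_gt\<close>)
    moreover have "winding_number ?r s = 1"
      using s abs b by (intro winding_number_rectpath) (auto simp: in_box_complex_iff)
    ultimately have "((\<lambda>w. - ((f w / w) / (w - s))) has_contour_integral - (2 * pi * \<i> * (f s / s))) ?r"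
      by (intro has_contour_integral_neg) simp
    moreover have "(\<lambda>w. - ((f w / w) / (w - s))) = ?h"
    proof
      fix w
      have "- ((f w / w) / (w - s)) = (f w / w) / (s - w)"
        by (metis minus_diff_eq minus_divide_right)
      then show "- ((f w / w) / (w - s)) = ?h w" by simp
    qed
    ultimately have cauchy: "contour_integral ?r ?h = - (2 * pi * \<i> * (f s / s))"
      by (simp add: contour_integral_unique)
    have hcont: "continuous_on (path_image ?r) ?h"
    proof -
      have "continuous_on (path_image ?r) f" by (rule continuous_on_subset[OF fcont]) (use sub in auto)
      then show ?thesis using sub b by (intro continuous_intros) auto
    qed
    have bound: "norm (contour_integral (linepath u v) ?h) \<le> K / (N * (N - norm s)) * norm (v - u)"
      if seg: "closed_segment u v \<subseteq> path_image ?r"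
        and far: "\<And>\<eta>. \<eta> \<in> closed_segment u v \<Longrightarrow> Re \<eta> \<ge> c \<and> (Re \<eta> = c + N \<or> \<bar>Im \<eta>\<bar> = N)" for u v
    proof (rule contour_integral_bound_linepath)
      show "?h contour_integrable_on linepath u v"
        by (intro contour_integrable_continuous_linepath continuous_on_subset[OF hcont seg])
      show "0 \<le> K / (N * (N - norm s))" using K0 N by simp
      fix \<eta> assume "\<eta> \<in> closed_segment u v"
      from far[OF this] have \<eta>: "Re \<eta> \<ge> c" "Re \<eta> = c + N \<or> \<bar>Im \<eta>\<bar> = N" by auto
      have N_le: "N \<le> norm \<eta>"
        using \<eta> b abs_Re_le_cmod[of \<eta>] abs_Im_le_cmod[of \<eta>] by auto
      have "N - norm s \<le> norm (s - \<eta>)"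
        using N_le norm_triangle_ineq2[of \<eta> s] by (simp add: norm_minus_commute)
      then have "N * (N - norm s) \<le> norm \<eta> * norm (s - \<eta>)"
        using N N_le by (intro mult_mono) auto
      then show "norm (?h \<eta>) \<le> K / (N * (N - norm s))"
        unfolding norm_divide norm_mult using N K[OF \<eta>(1)] K0 by (intro frac_le) auto
    qed
    have len: "norm (Complex (c + N) (- N) - Complex c (- N)) = N"
       "norm (Complex (c + N) N - Complex (c + N) (- N)) = 2 * N"
       "norm (Complex (c + N) N - Complex c N) = N"
      using N by (simp_all add: cmod_def real_sqrt_mult)
    let ?I1 = "contour_integral (linepath (Complex c (- N)) (Complex (c + N) (- N))) ?h"
    let ?I2 = "contour_integral (linepath (Complex (c + N) (- N)) (Complex (c + N) N)) ?h"
    let ?I3 = "contour_integral (linepath (Complex c N) (Complex (c + N) N)) ?h"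
    let ?C = "K / (N * (N - norm s))"
    have B1: "norm ?I1 \<le> ?C * N"
    proof -
      have seg: "closed_segment (Complex c (- N)) (Complex (c + N) (- N)) = {z. Im z = - N \<and> Re z \<in> {c..c + N}}"
        using N by (simp add: closed_segment_same_Im closed_segment_same_Re closed_segment_eq_real_ivl)
      have "closed_segment (Complex c (- N)) (Complex (c + N) (- N)) \<subseteq> path_image ?r"
        unfolding seg img using N by auto
      then have "norm ?I1 \<le> ?C * norm (Complex (c + N) (- N) - Complex c (- N))"
      proof (rule bound)
        show "Re \<eta> \<ge> c \<and> (Re \<eta> = c + N \<or> \<bar>Im \<eta>\<bar> = N)" if "\<eta> \<in> closed_segment (Complex c (- N)) (Complex (c + N) (- N))" for \<eta>
          using that N unfolding seg by auto
      qed
      then show ?thesis by (simp only: len)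
    qed
    have B2: "norm ?I2 \<le> ?C * (2 * N)"
    proof -
      have seg: "closed_segment (Complex (c + N) (- N)) (Complex (c + N) N) = {z. Re z = c + N \<and> Im z \<in> {- N..N}}"
        using N by (simp add: closed_segment_same_Im closed_segment_same_Re closed_segment_eq_real_ivl)
      have "closed_segment (Complex (c + N) (- N)) (Complex (c + N) N) \<subseteq> path_image ?r"
        unfolding seg img using N by auto
      then have "norm ?I2 \<le> ?C * norm (Complex (c + N) N - Complex (c + N) (- N))"
      proof (rule bound)
        show "Re \<eta> \<ge> c \<and> (Re \<eta> = c + N \<or> \<bar>Im \<eta>\<bar> = N)" if "\<eta> \<in> closed_segment (Complex (c + N) (- N)) (Complex (c + N) N)" for \<eta>
          using that N unfolding seg by auto
      qed
      then show ?thesis by (simp only: len)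
    qed
    have B3: "norm ?I3 \<le> ?C * N"
    proof -
      have seg: "closed_segment (Complex c N) (Complex (c + N) N) = {z. Im z = N \<and> Re z \<in> {c..c + N}}"
        using N by (simp add: closed_segment_same_Im closed_segment_same_Re closed_segment_eq_real_ivl)
      have "closed_segment (Complex c N) (Complex (c + N) N) \<subseteq> path_image ?r"
        unfolding seg img using N by auto
      then have "norm ?I3 \<le> ?C * norm (Complex (c + N) N - Complex c N)"
      proof (rule bound)
        show "Re \<eta> \<ge> c \<and> (Re \<eta> = c + N \<or> \<bar>Im \<eta>\<bar> = N)" if "\<eta> \<in> closed_segment (Complex c N) (Complex (c + N) N)" for \<eta>
          using that N unfolding seg by auto
      qed
      then show ?thesis by (simp only: len)
    qed
    have "set_integrable lborel {- N..N} (\<lambda>t. ?h (Complex c t))"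
      by (rule set_integrable_subset[OF int]) auto
    then have "contour_integral (linepath (Complex c (- N)) (Complex c N)) ?h =
        \<i> * (LINT t:{- N..N}|lborel. ?h (Complex c t))"
      by (rule vertical_linepath_integral[OF N(2)])
    then have eq: "\<i> * (LINT t:{- N..N}|lborel. ?h (Complex c t)) - 2 * of_real pi * \<i> * (f s / s) = ?I1 + ?I2 - ?I3"
      using contour_integral_rectpath[OF hcont] cauchy by (simp add: algebra_simps)
    have "norm (?I1 + ?I2 - ?I3) \<le> norm ?I1 + norm ?I2 + norm ?I3"
      using norm_triangle_ineq4[of "?I1 + ?I2" ?I3] norm_triangle_ineq[of ?I1 ?I2] by linarith
    also have "\<dots> \<le> ?C * N + ?C * (2 * N) + ?C * N" by (intro add_mono B1 B2 B3)
    also have "\<dots> = ?C * (4 * N)" by (simp only: distrib_left[symmetric]) simp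
    also have "\<dots> = 4 * K / (N - norm s)" using N by simp
    finally show ?thesis unfolding N_def eq[unfolded N_def] .
  qed
  have un: "(\<Union>n. {- real n..real n}) = UNIV"
  proof (intro equalityI subsetI)
    fix x :: real
    obtain n where "\<bar>x\<bar> \<le> real n" using real_arch_simple by blast
    then show "x \<in> (\<Union>n. {- real n..real n})" by (auto intro!: exI[of _ n])
  qed auto
  have "(\<lambda>n. LINT t:{- real n..real n}|lborel. ?h (Complex c t)) \<longlonglongrightarrow>
      (LINT t:(\<Union>n. {- real n..real n})|lborel. ?h (Complex c t))"
    by (rule set_integral_cont_up) (use int in \<open>auto simp: incseq_def un\<close>)
  then have "(\<lambda>n. \<i> * (LINT t:{- real n..real n}|lborel. ?h (Complex c t)) - 2 * of_real pi * \<i> * (f s / s)) \<longlonglongrightarrow>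
      \<i> * (LINT t:UNIV|lborel. ?h (Complex c t)) - 2 * of_real pi * \<i> * (f s / s)"
    unfolding un by (intro tendsto_intros)
  moreover have "(\<lambda>n. \<i> * (LINT t:{- real n..real n}|lborel. ?h (Complex c t)) - 2 * of_real pi * \<i> * (f s / s)) \<longlonglongrightarrow> 0"
  proof (rule Lim_null_comparison)
    show "\<forall>\<^sub>F n in sequentially. norm (\<i> * (LINT t:{- real n..real n}|lborel. ?h (Complex c t)) - 2 * of_real pi * \<i> * (f s / s))
        \<le> 4 * K / (real n - norm s)"
      using filterlim_real_sequentially[unfolded filterlim_at_top_dense, rule_format, of "norm s"]
      by eventually_elim (rule main)
    have "filterlim (\<lambda>n. real n - norm s) at_top sequentially"
      using filterlim_tendsto_add_at_top[OF tendsto_const filterlim_real_sequentially, of "- norm s"] by simp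
    then show "(\<lambda>n. 4 * K / (real n - norm s)) \<longlonglongrightarrow> 0"
      by (intro tendsto_divide_0[OF tendsto_const] filterlim_at_top_imp_at_infinity)
  qed
  ultimately have "\<i> * (LINT t:UNIV|lborel. ?h (Complex c t)) - 2 * of_real pi * \<i> * (f s / s) = 0"
    by (rule LIMSEQ_unique)
  moreover have "2 * of_real pi * \<i> * (f s / s) = \<i> * (2 * of_real pi * f s / s)"
    by (simp only: times_divide_eq_right mult.assoc mult.left_commute)
  ultimately have "\<i> * (LINT t:UNIV|lborel. ?h (Complex c t)) = \<i> * (2 * of_real pi * f s / s)"
    by (simp only: right_minus_eq)
  then show "(LINT t:UNIV|lborel. ?h (Complex c t)) = 2 * of_real pi * f s / s"
    using mult_left_cancel[OF complex_i_not_zero] by (simp only:)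
qed

section \<open>The contour and the region to its right\<close>

lemma path_image_bounded_part:
  assumes "\<sigma>1 \<le> \<sigma>3" "0 \<le> T"
  shows "path_image (bounded_part \<sigma>1 \<sigma>3 T) =
    {z. Im z = - T \<and> Re z \<in> {\<sigma>1..\<sigma>3}} \<union> {z. Re z = \<sigma>1 \<and> Im z \<in> {- T..T}} \<union>
    {z. Im z = T \<and> Re z \<in> {\<sigma>1..\<sigma>3}}"
  using assms
  by (auto simp: bounded_part_def path_image_join closed_segment_same_Re closed_segment_same_Im
        closed_segment_eq_real_ivl)

lemma right_of_contour_disjoint:
  assumes "\<sigma>1 < \<sigma>3" "0 < T" "\<eta> \<in> contour_set \<sigma>1 \<sigma>3 T"
  shows "\<eta> \<notin> right_of_contour \<sigma>1 \<sigma>3 T"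
  using assms by (auto simp: contour_set_def right_of_contour_def path_image_bounded_part)

lemma open_right_of_contour: "open (right_of_contour \<sigma>1 \<sigma>3 T)"
proof -
  have "right_of_contour \<sigma>1 \<sigma>3 T =
      {s. \<sigma>3 < Re s} \<union> ({s. \<sigma>1 < Re s} \<inter> {s. Im s < T} \<inter> {s. - T < Im s})"
    by (auto simp: right_of_contour_def)
  also have "open \<dots>"
    by (intro open_Un open_Int open_halfspace_Re_gt open_halfspace_Im_lt open_halfspace_Im_gt)
  finally show ?thesis .
qed

lemma dirichlet_term_norm_antimono:
  assumes "Re s \<le> Re z" "n > 0"
  shows "norm (dirichlet_term a z n) \<le> norm (dirichlet_term a s n)"
proof -
  have "norm (of_nat n powr (- z)) \<le> norm (of_nat n powr (- s) :: complex)"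
    using norm_of_real_powr[of "real n"] assms by (simp add: powr_mono)
  then show ?thesis unfolding dirichlet_term_def norm_mult by (intro mult_left_mono) auto
qed

section \<open>The Mellin transform of the error term\<close>

locale dirichlet_contour =
  fixes a :: "nat \<Rightarrow> real" and D :: "complex \<Rightarrow> complex"
    and \<sigma>1 \<sigma>2 \<sigma>3 T0 :: real and P :: "complex set"
  assumes \<sigma>: "0 < \<sigma>1" "\<sigma>1 < \<sigma>2" "\<sigma>2 < \<sigma>3" and T0: "0 < T0"
    and summ: "\<And>s. Re s > \<sigma>2 \<Longrightarrow> summable (\<lambda>n. norm (dirichlet_term a s (Suc n)))"
    and D_eq: "\<And>s. Re s > \<sigma>2 \<Longrightarrow> D s = (\<Sum>n. dirichlet_term a s (Suc n))"
    and holo: "D holomorphic_on {s. Re s > \<sigma>1} - P"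
    and fin: "finite P"
    and P_Re: "\<And>\<rho>. \<rho> \<in> P \<Longrightarrow> \<sigma>1 < Re \<rho> \<and> Re \<rho> \<le> \<sigma>2"
    and P_Im: "\<And>\<rho>. \<rho> \<in> P \<Longrightarrow> \<bar>Im \<rho>\<bar> < T0"
    and ana: "D analytic_on contour_set \<sigma>1 \<sigma>3 T0"
begin

abbreviation region :: "complex set" where
  "region \<equiv> right_of_contour \<sigma>1 \<sigma>3 T0"

abbreviation kernel :: "complex \<Rightarrow> complex \<Rightarrow> complex" where
  "kernel s \<equiv> \<lambda>\<eta>. D \<eta> / (\<eta> * (s - \<eta>))"

definition contour_transform :: "complex \<Rightarrow> complex" where
  "contour_transform s = 1 / (2 * of_real pi * \<i>) * full_contour_integral \<sigma>1 \<sigma>3 T0 (kernel s)"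

lemma D_holomorphic_right: "D holomorphic_on {s. Re s > \<sigma>2}"
  by (rule holomorphic_on_subset[OF holo]) (use P_Re \<sigma> in force)

lemma D_bounded: "\<exists>K. \<forall>\<eta>. Re \<eta> \<ge> \<sigma>3 \<longrightarrow> norm (D \<eta>) \<le> K"
proof (intro exI allI impI)
  fix \<eta> assume \<eta>: "Re \<eta> \<ge> \<sigma>3"
  let ?s = "complex_of_real \<sigma>3"
  have "norm (D \<eta>) = norm (\<Sum>n. dirichlet_term a \<eta> (Suc n))" using D_eq \<eta> \<sigma> by simp
  also have "\<dots> \<le> (\<Sum>n. norm (dirichlet_term a \<eta> (Suc n)))"
    using summ[of \<eta>] \<eta> \<sigma> by (intro summable_norm) simp
  also have "\<dots> \<le> (\<Sum>n. norm (dirichlet_term a ?s (Suc n)))"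
    using summ[of \<eta>] summ[of ?s] \<eta> \<sigma> by (intro suminf_le dirichlet_term_norm_antimono) auto
  finally show "norm (D \<eta>) \<le> (\<Sum>n. norm (dirichlet_term a ?s (Suc n)))" .
qed

text \<open>
  The residue theorem needs a domain that contains the closed rectangle, but the left side of the
  rectangle lies on the boundary of the half plane where \<open>D\<close> is given. Analyticity on
  the contour, together with compactness of that side, provides a margin.
\<close>

lemma rectangle_neighbourhood:
  obtains B where "open B" "convex B" "cbox (Complex \<sigma>1 (- T0)) (Complex \<sigma>3 T0) \<subseteq> B"
    "D holomorphic_on B - P" "B \<subseteq> {z. Re z > 0}"
proof -
  obtain U where U: "open U" "contour_set \<sigma>1 \<sigma>3 T0 \<subseteq> U" "D holomorphic_on U"
    using ana unfolding analytic_on_holomorphic by blast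
  let ?L = "closed_segment (Complex \<sigma>1 (- T0)) (Complex \<sigma>1 T0)"
  have L: "?L = {z. Re z = \<sigma>1 \<and> Im z \<in> {- T0..T0}}"
    using T0 by (simp add: closed_segment_same_Re closed_segment_eq_real_ivl)
  have "?L \<subseteq> U"
    using U(2) \<sigma> T0 unfolding L by (auto simp: contour_set_def path_image_bounded_part)
  then obtain \<epsilon> where \<epsilon>: "\<epsilon> > 0" "(\<Union>y\<in>?L. ball y \<epsilon>) \<subseteq> U"
    using compact_subset_open_imp_ball_epsilon_subset[OF compact_segment U(1)] by blast
  define \<delta> where "\<delta> = min (\<epsilon> / 2) \<sigma>1"
  have \<delta>: "\<delta> > 0" "2 * \<delta> \<le> \<epsilon>" "\<delta> \<le> \<sigma>1" using \<epsilon> \<sigma> by (auto simp: \<delta>_def)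
  define B where "B = {z. \<sigma>1 - \<delta> < Re z} \<inter> {z. Im z < T0 + \<delta>} \<inter> {z. - T0 - \<delta> < Im z}"
  have B_sub: "B - P \<subseteq> ({s. Re s > \<sigma>1} - P) \<union> U"
  proof
    fix z assume z: "z \<in> B - P"
    show "z \<in> ({s. Re s > \<sigma>1} - P) \<union> U"
    proof (cases "Re z > \<sigma>1")
      case False
      \<comment> \<open>The point of the left side closest to \<open>z\<close>.\<close>
      define y where "y = Complex \<sigma>1 (max (- T0) (min T0 (Im z)))"
      have "y \<in> ?L" using T0 unfolding L y_def by auto
      have "norm (y - z) \<le> \<bar>Re (y - z)\<bar> + \<bar>Im (y - z)\<bar>" by (rule cmod_le)
      also have "\<dots> < 2 * \<delta>"
        using z False \<delta> unfolding B_def y_def by (auto simp: max_def min_def abs_if)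
      finally have "z \<in> ball y \<epsilon>" using \<delta> by (simp add: dist_norm)
      with \<open>y \<in> ?L\<close> \<epsilon> show ?thesis by blast
    qed (use z in auto)
  qed
  have "open ({s. Re s > \<sigma>1} - P)"
    using fin by (intro open_Diff open_halfspace_Re_gt finite_imp_closed)
  then have "D holomorphic_on ({s. Re s > \<sigma>1} - P) \<union> U"
    using holo U by (intro holomorphic_on_Un)
  then have "D holomorphic_on B - P" using B_sub holomorphic_on_subset by blast
  moreover have "open B" unfolding B_def
    by (intro open_Int open_halfspace_Re_gt open_halfspace_Im_lt open_halfspace_Im_gt)
  moreover have "convex B" unfolding B_def
    by (intro convex_Int convex_halfspace_Re_gt convex_halfspace_Im_lt convex_halfspace_Im_gt)
  moreover have "cbox (Complex \<sigma>1 (- T0)) (Complex \<sigma>3 T0) \<subseteq> B"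
    using \<delta> by (auto simp: B_def in_cbox_complex_iff)
  moreover have "B \<subseteq> {z. Re z > 0}" using \<delta> by (auto simp: B_def)
  ultimately show thesis using that by blast
qed

lemma D_continuous_contour: "continuous_on (contour_set \<sigma>1 \<sigma>3 T0) D"
  using ana by (intro holomorphic_on_imp_continuous_on analytic_imp_holomorphic)

lemma Re_contour_pos: "\<eta> \<in> contour_set \<sigma>1 \<sigma>3 T0 \<Longrightarrow> 0 < Re \<eta>"
  using \<sigma> T0 by (auto simp: contour_set_def path_image_bounded_part)

lemma quotient_continuous_bounded_part:
  "continuous_on (path_image (bounded_part \<sigma>1 \<sigma>3 T0)) (\<lambda>\<eta>. D \<eta> / \<eta>)"
proof -
  have sub: "path_image (bounded_part \<sigma>1 \<sigma>3 T0) \<subseteq> contour_set \<sigma>1 \<sigma>3 T0"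
    by (auto simp: contour_set_def)
  have "\<eta> \<noteq> 0" if "\<eta> \<in> path_image (bounded_part \<sigma>1 \<sigma>3 T0)" for \<eta>
    using sub Re_contour_pos that by force
  then show ?thesis
    using continuous_on_subset[OF D_continuous_contour sub] by (intro continuous_intros) auto
qed

lemma quotient_continuous_right_edge:
  "continuous_on (closed_segment (Complex \<sigma>3 (- T0)) (Complex \<sigma>3 T0)) (\<lambda>\<eta>. D \<eta> / \<eta>)"
proof -
  have "continuous_on {\<eta>. Re \<eta> > \<sigma>2} (\<lambda>\<eta>. D \<eta> / \<eta>)"
    using holomorphic_on_imp_continuous_on[OF D_holomorphic_right] \<sigma> by (intro continuous_intros) auto
  then show ?thesis
    by (rule continuous_on_subset) (use \<sigma> in \<open>auto simp: closed_segment_same_Re\<close>)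
qed

lemma bounded_part_segments:
  "closed_segment (Complex \<sigma>1 (- T0)) (Complex \<sigma>3 (- T0)) \<subseteq> path_image (bounded_part \<sigma>1 \<sigma>3 T0)"
  "closed_segment (Complex \<sigma>1 (- T0)) (Complex \<sigma>1 T0) \<subseteq> path_image (bounded_part \<sigma>1 \<sigma>3 T0)"
  "closed_segment (Complex \<sigma>1 T0) (Complex \<sigma>3 T0) \<subseteq> path_image (bounded_part \<sigma>1 \<sigma>3 T0)"
  by (auto simp: bounded_part_def path_image_join closed_segment_commute)

text \<open>
  All points of \<open>P\<close> lie inside the rectangle formed by the bounded part and the segment from
  \<open>\<sigma>3 - \<i> T0\<close> to \<open>\<sigma>3 + \<i> T0\<close>, so the sum of residues is a single contour integral.
\<close>

lemma main_term_eq_contour_integral: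
  assumes x: "x > 0"
  shows "main_term D P x = 1 / (2 * of_real pi * \<i>) *
    (contour_integral (linepath (Complex \<sigma>3 (- T0)) (Complex \<sigma>3 T0)) (\<lambda>\<eta>. D \<eta> / \<eta> * of_real x powr \<eta>) -
     contour_integral (bounded_part \<sigma>1 \<sigma>3 T0) (\<lambda>\<eta>. D \<eta> / \<eta> * of_real x powr \<eta>))"
proof -
  let ?h = "\<lambda>\<eta>. D \<eta> / \<eta> * complex_of_real x powr \<eta>"
  let ?r = "rectpath (Complex \<sigma>1 (- T0)) (Complex \<sigma>3 T0)"
  obtain B where B: "open B" "convex B" "cbox (Complex \<sigma>1 (- T0)) (Complex \<sigma>3 T0) \<subseteq> B"
    "D holomorphic_on B - P" "B \<subseteq> {z. Re z > 0}" by (rule rectangle_neighbourhood)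
  have P_in: "\<rho> \<in> box (Complex \<sigma>1 (- T0)) (Complex \<sigma>3 T0)" if "\<rho> \<in> P" for \<rho>
    using P_Re[OF that] P_Im[OF that] \<sigma> by (auto simp: in_box_complex_iff)
  have h_holo: "?h holomorphic_on B - P"
    using B x by (intro holomorphic_intros) auto
  have img: "path_image ?r \<subseteq> B - P"
    using B(3) P_in \<sigma> T0 by (subst path_image_rectpath_cbox_minus_box) auto
  have h_cont: "continuous_on (path_image ?r) ?h"
    using h_holo img holomorphic_on_imp_continuous_on continuous_on_subset by blast
  have "contour_integral ?r ?h = 2 * pi * \<i> * (\<Sum>\<rho>\<in>P. winding_number ?r \<rho> * residue ?h \<rho>)"
  proof (rule Residue_theorem[OF B(1) convex_connected[OF B(2)] fin h_holo])
    show "\<forall>z. z \<notin> B \<longrightarrow> winding_number ?r z = 0"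
      using B(3) \<sigma> T0 by (intro allI impI winding_number_rectpath_outside) auto
  qed (use img in auto)
  also have "(\<Sum>\<rho>\<in>P. winding_number ?r \<rho> * residue ?h \<rho>) = (\<Sum>\<rho>\<in>P. residue ?h \<rho>)"
    by (intro sum.cong) (use P_in winding_number_rectpath in auto)
  also have "\<dots> = main_term D P x" by (simp add: main_term_def)
  finally have res: "contour_integral ?r ?h = 2 * pi * \<i> * main_term D P x" .
  have b_cont: "continuous_on (path_image (bounded_part \<sigma>1 \<sigma>3 T0)) ?h"
    by (rule continuous_on_mult[OF quotient_continuous_bounded_part])
       (use x in \<open>auto intro!: continuous_intros\<close>)
  have "contour_integral ?r ?h =
      contour_integral (linepath (Complex \<sigma>3 (- T0)) (Complex \<sigma>3 T0)) ?h -
      contour_integral (bounded_part \<sigma>1 \<sigma>3 T0) ?h"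
    unfolding contour_integral_rectpath[OF h_cont] contour_integral_bounded_part(2)[OF b_cont] by simp
  with res show ?thesis by (simp add: field_simps)
qed

lemma has_mellin_linepath:
  assumes "continuous_on (closed_segment u v) (\<lambda>\<eta>. D \<eta> / \<eta>)" "Re u \<le> \<sigma>3" "Re v \<le> \<sigma>3" "\<sigma>3 < Re s"
  shows "has_mellin (\<lambda>x. contour_integral (linepath u v) (\<lambda>\<eta>. D \<eta> / \<eta> * of_real x powr \<eta>)) s
    (contour_integral (linepath u v) (kernel s))"
  using mellin_linepath_integral[OF assms] unfolding has_mellin_def divide_divide_eq_left by blast

lemma kernel_continuous_bounded_part:
  assumes "s \<in> region"
  shows "continuous_on (path_image (bounded_part \<sigma>1 \<sigma>3 T0)) (kernel s)"
proof -
  have "s - \<eta> \<noteq> 0" if "\<eta> \<in> path_image (bounded_part \<sigma>1 \<sigma>3 T0)" for \<eta>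
    using right_of_contour_disjoint[of \<sigma>1 \<sigma>3 T0 \<eta>] \<sigma> T0 assms that by (auto simp: contour_set_def)
  then have "continuous_on (path_image (bounded_part \<sigma>1 \<sigma>3 T0)) (\<lambda>\<eta>. D \<eta> / \<eta> / (s - \<eta>))"
    by (intro continuous_on_divide[OF quotient_continuous_bounded_part] continuous_intros) auto
  then show ?thesis by simp
qed

lemma has_mellin_bounded_part:
  assumes s: "\<sigma>3 < Re s"
  shows "has_mellin (\<lambda>x. contour_integral (bounded_part \<sigma>1 \<sigma>3 T0) (\<lambda>\<eta>. D \<eta> / \<eta> * of_real x powr \<eta>)) s
    (contour_integral (bounded_part \<sigma>1 \<sigma>3 T0) (kernel s))"
proof -
  let ?I = "\<lambda>u v f. contour_integral (linepath u v) f"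
  let ?h = "\<lambda>x \<eta>. D \<eta> / \<eta> * complex_of_real x powr \<eta>"
  have b_cont: "continuous_on (path_image (bounded_part \<sigma>1 \<sigma>3 T0)) (?h x)" if "x \<ge> 1" for x
    by (rule continuous_on_mult[OF quotient_continuous_bounded_part])
       (use that in \<open>auto intro!: continuous_intros\<close>)
  have "s \<in> region" using s by (simp add: right_of_contour_def)
  note k_cont = kernel_continuous_bounded_part[OF this]
  note cont = continuous_on_subset[OF quotient_continuous_bounded_part]
  have "has_mellin (\<lambda>x. (- 1) * ?I (Complex \<sigma>1 (- T0)) (Complex \<sigma>3 (- T0)) (?h x) +
      ?I (Complex \<sigma>1 (- T0)) (Complex \<sigma>1 T0) (?h x) + ?I (Complex \<sigma>1 T0) (Complex \<sigma>3 T0) (?h x)) s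
    ((- 1) * ?I (Complex \<sigma>1 (- T0)) (Complex \<sigma>3 (- T0)) (kernel s) +
      ?I (Complex \<sigma>1 (- T0)) (Complex \<sigma>1 T0) (kernel s) + ?I (Complex \<sigma>1 T0) (Complex \<sigma>3 T0) (kernel s))"
    using \<sigma> s by (intro has_mellin_add has_mellin_cmult has_mellin_linepath cont bounded_part_segments) auto
  then show ?thesis
    unfolding contour_integral_bounded_part(2)[OF k_cont]
    by (subst has_mellin_cong) (use contour_integral_bounded_part(2)[OF b_cont] in auto)
qed

lemma has_mellin_main_term:
  assumes s: "\<sigma>3 < Re s"
  shows "has_mellin (main_term D P) s (1 / (2 * of_real pi * \<i>) *
    (contour_integral (linepath (Complex \<sigma>3 (- T0)) (Complex \<sigma>3 T0)) (kernel s) -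
     contour_integral (bounded_part \<sigma>1 \<sigma>3 T0) (kernel s)))"
proof (subst has_mellin_cong[OF main_term_eq_contour_integral])
  show "has_mellin (\<lambda>x. 1 / (2 * of_real pi * \<i>) *
    (contour_integral (linepath (Complex \<sigma>3 (- T0)) (Complex \<sigma>3 T0)) (\<lambda>\<eta>. D \<eta> / \<eta> * of_real x powr \<eta>) -
     contour_integral (bounded_part \<sigma>1 \<sigma>3 T0) (\<lambda>\<eta>. D \<eta> / \<eta> * of_real x powr \<eta>))) s
    (1 / (2 * of_real pi * \<i>) *
    (contour_integral (linepath (Complex \<sigma>3 (- T0)) (Complex \<sigma>3 T0)) (kernel s) -
     contour_integral (bounded_part \<sigma>1 \<sigma>3 T0) (kernel s)))"
    by (intro has_mellin_cmult has_mellin_diff has_mellin_bounded_part has_mellin_linepath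
        quotient_continuous_right_edge s) auto
qed auto

lemma D_continuous_line: "continuous_on UNIV (\<lambda>t. D (Complex \<sigma>3 t))"
  by (rule continuous_on_compose2[OF holomorphic_on_imp_continuous_on[OF D_holomorphic_right]
      continuous_on_Complex_line]) (use \<sigma> in auto)

lemma ray_integrals:
  assumes T: "T = {..- T0} \<or> T = {T0..}"
  shows "s \<in> region \<Longrightarrow> set_integrable lborel T (\<lambda>t. kernel s (Complex \<sigma>3 t))"
    and "(\<lambda>s. LINT t:T|lborel. kernel s (Complex \<sigma>3 t)) holomorphic_on region"
proof -
  obtain K where K: "\<And>\<eta>. Re \<eta> \<ge> \<sigma>3 \<Longrightarrow> norm (D \<eta>) \<le> K" using D_bounded by blast
  have disj: "Complex \<sigma>3 t \<notin> region" if "t \<in> T" for t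
    using T that by (auto simp: right_of_contour_def)
  have c: "0 < \<sigma>3" using \<sigma> by simp
  have meas: "T \<in> sets borel" using T by auto
  have bd: "norm (D (Complex \<sigma>3 t)) \<le> K" for t by (rule K) simp
  show "s \<in> region \<Longrightarrow> set_integrable lborel T (\<lambda>t. kernel s (Complex \<sigma>3 t))"
    by (rule vertical_line_kernel(1)[OF c meas D_continuous_line bd open_right_of_contour disj])
  show "(\<lambda>s. LINT t:T|lborel. kernel s (Complex \<sigma>3 t)) holomorphic_on region"
    by (rule vertical_line_kernel(2)[OF c meas D_continuous_line bd open_right_of_contour disj])
qed

lemma kernel_integrable:
  assumes "s \<in> region"
  shows "full_contour_integrable \<sigma>1 \<sigma>3 T0 (kernel s)"
  unfolding full_contour_integrable_def
  using assms by (intro conjI ray_integrals contour_integral_bounded_part kernel_continuous_bounded_part) auto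

lemma contour_transform_holomorphic: "contour_transform holomorphic_on region"
proof -
  let ?I = "\<lambda>u v s. contour_integral (linepath u v) (kernel s)"
  have seg: "?I u v holomorphic_on region"
    if "closed_segment u v \<subseteq> path_image (bounded_part \<sigma>1 \<sigma>3 T0)" for u v
  proof -
    have "closed_segment u v \<inter> region = {}"
      using right_of_contour_disjoint[of \<sigma>1 \<sigma>3 T0] \<sigma> T0 that by (auto simp: contour_set_def)
    from linepath_cauchy_transform_holomorphic[OF
        continuous_on_subset[OF quotient_continuous_bounded_part that] open_right_of_contour this]
    show ?thesis by (simp only: divide_divide_eq_left)
  qed
  have "(\<lambda>s. 1 / (2 * of_real pi * \<i>) * (\<i> * (LINT t:{..- T0}|lborel. kernel s (Complex \<sigma>3 t)) +
      (- ?I (Complex \<sigma>1 (- T0)) (Complex \<sigma>3 (- T0)) s + ?I (Complex \<sigma>1 (- T0)) (Complex \<sigma>1 T0) s +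
        ?I (Complex \<sigma>1 T0) (Complex \<sigma>3 T0) s) +
      \<i> * (LINT t:{T0..}|lborel. kernel s (Complex \<sigma>3 t)))) holomorphic_on region"
    by (intro holomorphic_intros seg ray_integrals bounded_part_segments) auto
  then show ?thesis
    by (rule holomorphic_transform)
       (simp add: contour_transform_def full_contour_integral_def
          contour_integral_bounded_part(2)[OF kernel_continuous_bounded_part])
qed

text \<open>
  The whole line \<open>Re \<eta> = \<sigma>3\<close>, cut at height \<open>\<plusminus>T0\<close>, to be compared with the contour, which has the same two
  half-lines.
\<close>

lemma vertical_line_integral:
  assumes s: "\<sigma>3 < Re s"
  shows "\<i> * (LINT t:{..- T0}|lborel. kernel s (Complex \<sigma>3 t)) +
      contour_integral (linepath (Complex \<sigma>3 (- T0)) (Complex \<sigma>3 T0)) (kernel s) +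
      \<i> * (LINT t:{T0..}|lborel. kernel s (Complex \<sigma>3 t)) = 2 * of_real pi * \<i> * D s / s"
proof -
  obtain K where K: "\<And>\<eta>. Re \<eta> \<ge> \<sigma>3 \<Longrightarrow> norm (D \<eta>) \<le> K" using D_bounded by blast
  let ?k = "\<lambda>t. kernel s (Complex \<sigma>3 t)"
  have "0 \<le> \<sigma>2" using \<sigma> by simp
  note line = vertical_line_cauchy_formula[OF D_holomorphic_right this \<sigma>(3) K s]
  have int: "set_integrable lborel T ?k" if "T \<in> sets borel" for T
    by (rule set_integrable_subset[OF line(1)]) (use that in auto)
  have i: "integrable lborel (\<lambda>t. indicator T t *\<^sub>R ?k t)" if "T \<in> sets borel" for T
    using int[OF that] by (simp only: set_integrable_def)
  have "(LINT t:{..- T0}|lborel. ?k t) + (LINT t:{- T0..T0}|lborel. ?k t) + (LINT t:{T0..}|lborel. ?k t) =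
      (\<integral>t. indicator {..- T0} t *\<^sub>R ?k t + indicator {- T0..T0} t *\<^sub>R ?k t + indicator {T0..} t *\<^sub>R ?k t \<partial>lborel)"
    unfolding set_lebesgue_integral_def using i[of "{..- T0}"] i[of "{- T0..T0}"] i[of "{T0..}"]
    by simp
  also have "\<dots> = (LINT t:UNIV|lborel. ?k t)"
    unfolding set_lebesgue_integral_def
    \<comment> \<open>The three closed pieces overlap in the two cutting points.\<close>
    by (rule integral_discrete_difference[where X = "{- T0, T0}"])
       (use T0 in \<open>auto simp: indicator_def\<close>)
  also have "\<dots> = 2 * of_real pi * D s / s" by (rule line(2))
  finally have total: "(LINT t:{..- T0}|lborel. ?k t) + (LINT t:{- T0..T0}|lborel. ?k t) +
      (LINT t:{T0..}|lborel. ?k t) = 2 * of_real pi * D s / s" .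
  have "contour_integral (linepath (Complex \<sigma>3 (- T0)) (Complex \<sigma>3 T0)) (kernel s) =
      \<i> * (LINT t:{- T0..T0}|lborel. ?k t)"
    by (rule vertical_linepath_integral[OF T0 int]) simp
  then have "\<i> * (LINT t:{..- T0}|lborel. ?k t) +
      contour_integral (linepath (Complex \<sigma>3 (- T0)) (Complex \<sigma>3 T0)) (kernel s) +
      \<i> * (LINT t:{T0..}|lborel. ?k t) =
      \<i> * ((LINT t:{..- T0}|lborel. ?k t) + (LINT t:{- T0..T0}|lborel. ?k t) + (LINT t:{T0..}|lborel. ?k t))"
    by (simp only: distrib_left)
  then show ?thesis unfolding total by simp
qed

text \<open>
  In the difference of the starred sum's and the main term's transforms the segment from \<open>\<sigma>3 - \<i> T0\<close> to
  \<open>\<sigma>3 + \<i> T0\<close> cancels, and the contour remains.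
\<close>

lemma has_mellin_error_term:
  assumes s: "\<sigma>3 < Re s"
  shows "has_mellin (error_term a D P) s (contour_transform s)"
proof -
  have "has_mellin (\<lambda>x. complex_of_real (starred_sum a x)) s (D s / s)"
    using mellin_starred_sum[OF summ] D_eq s \<sigma> unfolding has_mellin_def by simp
  from has_mellin_diff[OF this has_mellin_main_term[OF s]]
  have "has_mellin (error_term a D P) s (D s / s - 1 / (2 * of_real pi * \<i>) *
    (contour_integral (linepath (Complex \<sigma>3 (- T0)) (Complex \<sigma>3 T0)) (kernel s) -
     contour_integral (bounded_part \<sigma>1 \<sigma>3 T0) (kernel s)))"
    unfolding error_term_def .
  moreover have "D s / s = 1 / (2 * of_real pi * \<i>) * (2 * of_real pi * \<i> * D s / s)" by simp
  ultimately show ?thesis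
    unfolding contour_transform_def full_contour_integral_def vertical_line_integral[OF s, symmetric]
    by (simp add: algebra_simps)
qed

abbreviation strip :: "real \<Rightarrow> complex set" where
  "strip \<sigma> \<equiv> {s. \<sigma> < Re s} \<inter> {s. Im s < T0} \<inter> {s. - T0 < Im s}"

text \<open>
  Strips are convex, so two holomorphic functions that agree far to the right agree throughout.
\<close>

lemma eq_on_strip:
  assumes "f holomorphic_on strip \<sigma>" "g holomorphic_on strip \<sigma>"
    and eq: "\<And>s. \<sigma>3 < Re s \<Longrightarrow> \<sigma> < Re s \<Longrightarrow> f s = g s" and z: "z \<in> strip \<sigma>"
  shows "f z = g z"
proof (rule analytic_continuation_open[OF _ _ _ _ _ assms(1,2) _ z])
  show "open (strip (max \<sigma> \<sigma>3))" "open (strip \<sigma>)"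
    by (intro open_Int open_halfspace_Re_gt open_halfspace_Im_lt open_halfspace_Im_gt)+
  have "of_real (max \<sigma> \<sigma>3 + 1) \<in> strip (max \<sigma> \<sigma>3)" using T0 by (auto simp: max_def)
  then show "strip (max \<sigma> \<sigma>3) \<noteq> {}" by blast
  show "connected (strip \<sigma>)"
    by (intro convex_connected convex_Int convex_halfspace_Re_gt convex_halfspace_Im_lt convex_halfspace_Im_gt)
qed (use eq in auto)

lemma strip_subset_region: "\<sigma>1 \<le> \<sigma> \<Longrightarrow> strip \<sigma> \<subseteq> region"
  by (auto simp: right_of_contour_def)

lemma contour_transform_mellin_continuation:
  "mellin_continuation (error_term a D P) region contour_transform"
  unfolding mellin_continuation_def
proof (intro conjI ballI impI)
  let ?M = "mellin_integral (error_term a D P)"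
  fix s0 assume s0: "s0 \<in> region" and conv: "mellin_abs_convergent (error_term a D P) s0"
  show "contour_transform s0 = ?M s0"
  proof (cases "\<sigma>3 < Re s0")
    case True
    then show ?thesis using has_mellin_error_term by (simp add: has_mellin_def)
  next
    case False
    with s0 have strip0: "\<sigma>1 < Re s0" "\<bar>Im s0\<bar> < T0" by (auto simp: right_of_contour_def)
    have eq: "contour_transform z = ?M z" if z: "z \<in> strip (Re s0)" for z
    proof (rule eq_on_strip[OF _ _ _ z])
      show "contour_transform holomorphic_on strip (Re s0)"
        using contour_transform_holomorphic strip_subset_region strip0 holomorphic_on_subset by (meson less_imp_le)
      show "?M holomorphic_on strip (Re s0)"
        by (rule holomorphic_on_subset[OF mellin_integral_holomorphic[OF conv]]) auto
    qed (use has_mellin_error_term in \<open>simp add: has_mellin_def\<close>)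
    let ?z = "\<lambda>n. s0 + complex_of_real (1 / real (Suc n))"
    have "(\<lambda>n. ?M (?z n)) \<longlonglongrightarrow> ?M s0" by (rule mellin_integral_tendsto_right[OF conv])
    moreover have "?M (?z n) = contour_transform (?z n)" for n
      using strip0 by (intro eq[symmetric]) (auto simp: abs_less_iff)
    ultimately have "(\<lambda>n. contour_transform (?z n)) \<longlonglongrightarrow> ?M s0" by simp
    moreover have "(\<lambda>n. contour_transform (?z n)) \<longlonglongrightarrow> contour_transform s0"
    proof -
      have cont: "isCont contour_transform s0"
        using contour_transform_holomorphic open_right_of_contour s0
          holomorphic_on_imp_continuous_on continuous_on_eq_continuous_at by blast
      show ?thesis by (rule isCont_tendsto_compose[OF cont tendsto_add_inverse_Suc])
    qed
    ultimately show ?thesis using LIMSEQ_unique by blast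
  qed
qed (rule contour_transform_holomorphic)

lemma mellin_continuation_unique:
  assumes A: "mellin_continuation (error_term a D P) region A" and s: "s \<in> region"
  shows "A s = contour_transform s"
proof -
  have far: "A z = contour_transform z" if "\<sigma>3 < Re z" for z
    using A has_mellin_error_term[OF that] that
    unfolding mellin_continuation_def has_mellin_def right_of_contour_def by auto
  show ?thesis
  proof (cases "\<sigma>3 < Re s")
    case False
    then have "s \<in> strip \<sigma>1" using s by (auto simp: right_of_contour_def)
    then show ?thesis
    proof (rule eq_on_strip[rotated -1])
      show "A holomorphic_on strip \<sigma>1"
        using A strip_subset_region[OF order_refl] holomorphic_on_subset
        unfolding mellin_continuation_def by blast
      show "contour_transform holomorphic_on strip \<sigma>1"
        using contour_transform_holomorphic strip_subset_region[OF order_refl] holomorphic_on_subset by blast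
    qed (rule far)
  qed (rule far)
qed

end

theorem theorem3:
  fixes a :: "nat \<Rightarrow> real" and D :: "complex \<Rightarrow> complex"
    and \<sigma>1 \<sigma>2 \<sigma>3 T0 :: real and P :: "complex set"
  assumes "0 < \<sigma>1" and "\<sigma>1 < \<sigma>2"
    and "\<And>s. Re s > \<sigma>2 \<Longrightarrow> summable (\<lambda>n. norm (dirichlet_term a s (Suc n)))"
    and "\<And>s. Re s > \<sigma>2 \<Longrightarrow> D s = (\<Sum>n. dirichlet_term a s (Suc n))"
    and "D meromorphic_on {s. Re s > \<sigma>1}"
    and "P = {\<rho>. Re \<rho> > \<sigma>1 \<and> is_pole D \<rho>}"
    and "D holomorphic_on {s. Re s > \<sigma>1} - P"
    and "finite P"
    and "\<And>\<rho>. \<rho> \<in> P \<Longrightarrow> Re \<rho> \<le> \<sigma>2"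
    and "\<sigma>3 > \<sigma>2" and "T0 > 0"
    and "\<And>\<rho>. \<rho> \<in> P \<Longrightarrow> \<bar>Im \<rho>\<bar> < T0"
    and "D analytic_on contour_set \<sigma>1 \<sigma>3 T0"
  shows "(\<exists>c. \<forall>s. Re s > c \<longrightarrow> mellin_abs_convergent (error_term a D P) s) \<and>
    (\<exists>A. mellin_continuation (error_term a D P) (right_of_contour \<sigma>1 \<sigma>3 T0) A) \<and>
    (\<forall>A. mellin_continuation (error_term a D P) (right_of_contour \<sigma>1 \<sigma>3 T0) A \<longrightarrow>
      (\<forall>s\<in>right_of_contour \<sigma>1 \<sigma>3 T0.
        full_contour_integrable \<sigma>1 \<sigma>3 T0 (\<lambda>\<eta>. D \<eta> / (\<eta> * (s - \<eta>))) \<and>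
        A s = 1 / (2 * of_real pi * \<i>) *
          full_contour_integral \<sigma>1 \<sigma>3 T0 (\<lambda>\<eta>. D \<eta> / (\<eta> * (s - \<eta>)))))"
proof -
  interpret dirichlet_contour a D \<sigma>1 \<sigma>2 \<sigma>3 T0 P
    by unfold_locales (use assms in auto)
  show ?thesis
  proof (intro conjI exI allI impI ballI)
    show "mellin_abs_convergent (error_term a D P) s" if "Re s > \<sigma>3" for s
      using has_mellin_error_term[OF that] by (simp add: has_mellin_def)
    show "mellin_continuation (error_term a D P) (right_of_contour \<sigma>1 \<sigma>3 T0) contour_transform"
      by (rule contour_transform_mellin_continuation)
  next
    fix A s
    assume A: "mellin_continuation (error_term a D P) (right_of_contour \<sigma>1 \<sigma>3 T0) A"
      and s: "s \<in> right_of_contour \<sigma>1 \<sigma>3 T0"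
    show "full_contour_integrable \<sigma>1 \<sigma>3 T0 (\<lambda>\<eta>. D \<eta> / (\<eta> * (s - \<eta>)))"
      by (rule kernel_integrable[OF s])
    show "A s = 1 / (2 * of_real pi * \<i>) *
        full_contour_integral \<sigma>1 \<sigma>3 T0 (\<lambda>\<eta>. D \<eta> / (\<eta> * (s - \<eta>)))"
      using mellin_continuation_unique[OF A s] unfolding contour_transform_def .
  qed
qed

end
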